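(* Let $m_{1},\ldots,m_{n}$ be positive integers, let $1\leq i_{1}<\cdots<i_{k}\leq n$, and let $\alpha_{1},\ldots,\alpha_{p-1}$ be $p-1$ distinct points of $\mathbf{C}$. Let $\Sigma$ be the complex plane punctured at $\alpha_{1},\ldots,\alpha_{p-1}$, or the universal cover of that punctured plane. Set $$\omega=\frac{dz}{\prod_{j=1}^{p-1}(z-\alpha_{j})}$$ and let the map $G=(g_{1},\ldots,g_{n})$ be given by $g_{i_{1}}=\cdots=g_{i_{k}}=z$, the other $g_i$ being constants in $\mathbf{C}$. Then all $g_{i_{l}}$ $(l=1,\ldots,k)$ omit the $p$ distinct values $\alpha_{1},\ldots,\alpha_{p-1},\infty$, and the metric $$ds^{2}=\prod_{i=1}^{n}(1+|g_{i}|^{2})^{m_{i}}\,|\omega|^{2}$$ on $\Sigma$ is complete if and only if $$p\leq 2+\sum_{l=1}^{k}m_{i_{l}}.$$ In particular, there exist such examples with $ds^2$ complete, in which each $g_{i_l}$ omits $q_{i_l}>2$ distinct values, and which satisfy the equality $$\sum_{l=1}^{k}\frac{m_{i_{l}}}{q_{i_{l}}-2}=1.$$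
   Context: The values of the $g_i$ are taken in the Riemann sphere $\overline{\mathbf{C}}=\mathbf{C}\cup\{\infty\}$; a map omits a value if it never attains it. Here $p\ge 1$ and $k\ge1$. When $\Sigma$ is the universal cover of the punctured plane, $z$ and $\omega$ denote the pullbacks to $\Sigma$, under the covering map, of the coordinate function $z$ and of the displayed $1$-form. *)

theory Defs
  imports "HOL-Analysis.Analysis"
begin

text \<open>
  A surface is a set \<open>S\<close> with a map \<open>z\<close> from \<open>S\<close> to the complex plane that is a local
  homeomorphism: the identity on a plane domain, or a covering map of it. The complex structure is
  the one pulled back along \<open>z\<close>, and a tangent vector \<open>v\<close> at a point \<open>x\<close> of \<open>S\<close> is identified with
  the complex number \<open>dz(v)\<close>. A path in \<open>S\<close> is therefore piecewise \<open>C\<^sup>1\<close> iff \<open>z \<circ> \<gamma>\<close> is,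
  and its velocity is the derivative of \<open>z \<circ> \<gamma>\<close>.
\<close>

definition punctured_plane :: "(nat \<Rightarrow> complex) \<Rightarrow> nat \<Rightarrow> complex set" where
  "punctured_plane \<alpha> p = UNIV - \<alpha> ` {1..p - 1}"

definition universal_cover ::
    "'a::topological_space set \<Rightarrow> ('a \<Rightarrow> 'b::topological_space) \<Rightarrow> 'b set \<Rightarrow> bool" where
  "universal_cover S z X \<longleftrightarrow> covering_space S z X \<and> simply_connected S"

text \<open>The Riemann sphere; \<open>None\<close> is the point at infinity.\<close>

type_synonym riemann_sphere = "complex option"

definition omitted_values :: "'a set \<Rightarrow> ('a \<Rightarrow> riemann_sphere) \<Rightarrow> riemann_sphere set" where
  "omitted_values S g = UNIV - g ` S"

definition omega :: "(nat \<Rightarrow> complex) \<Rightarrow> nat \<Rightarrow> ('a \<Rightarrow> complex) \<Rightarrow> 'a \<Rightarrow> complex \<Rightarrow> complex" where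
  "omega \<alpha> p z x v = v / (\<Prod>j = 1..p - 1. z x - \<alpha> j)"

definition Gmap ::
    "nat set \<Rightarrow> (nat \<Rightarrow> complex) \<Rightarrow> ('a \<Rightarrow> complex) \<Rightarrow> nat \<Rightarrow> 'a \<Rightarrow> complex" where
  "Gmap I c z i = (if i \<in> I then z else (\<lambda>_. c i))"

definition ds2 ::
    "nat \<Rightarrow> (nat \<Rightarrow> nat) \<Rightarrow> (nat \<Rightarrow> 'a \<Rightarrow> complex) \<Rightarrow> ('a \<Rightarrow> complex \<Rightarrow> complex)
      \<Rightarrow> 'a \<Rightarrow> complex \<Rightarrow> real" where
  "ds2 n m g \<omega> x v = (\<Prod>i = 1..n. (1 + (cmod (g i x))\<^sup>2) ^ m i) * (cmod (\<omega> x v))\<^sup>2"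

text \<open>
  Lengths are extended nonnegative reals because \<^const>\<open>valid_path\<close> does not bound the derivative
  near the exceptional parameters, so a path may have infinite length.
\<close>

definition curve_length ::
    "('a \<Rightarrow> complex) \<Rightarrow> ('a \<Rightarrow> complex \<Rightarrow> real) \<Rightarrow> (real \<Rightarrow> 'a) \<Rightarrow> ennreal" where
  "curve_length z h \<gamma> =
     (\<integral>\<^sup>+t\<in>{0..1}. ennreal (sqrt (h (\<gamma> t) (vector_derivative (z \<circ> \<gamma>) (at t)))) \<partial>lborel)"

definition piecewise_C1_paths ::
    "'a::topological_space set \<Rightarrow> ('a \<Rightarrow> complex) \<Rightarrow> 'a \<Rightarrow> 'a \<Rightarrow> (real \<Rightarrow> 'a) set" where
  "piecewise_C1_paths S z x y =
     {\<gamma>. path \<gamma> \<and> path_image \<gamma> \<subseteq> S \<and> pathstart \<gamma> = x \<and> pathfinish \<gamma> = y \<and> valid_path (z \<circ> \<gamma>)}"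

text \<open>
  Meaningful for path-connected \<open>S\<close>. The value is \<open>0\<close> if \<open>x\<close> or \<open>y\<close> lies outside \<open>S\<close>; the locale
  \<^locale>\<open>Metric_space\<close> requires symmetry and nonnegativity there too.
\<close>

definition riemannian_dist ::
    "'a::topological_space set \<Rightarrow> ('a \<Rightarrow> complex) \<Rightarrow> ('a \<Rightarrow> complex \<Rightarrow> real) \<Rightarrow> 'a \<Rightarrow> 'a \<Rightarrow> real" where
  "riemannian_dist S z h x y =
     enn2real (INF \<gamma> \<in> piecewise_C1_paths S z x y. curve_length z h \<gamma>)"

definition complete_riemannian_metric ::
    "'a::topological_space set \<Rightarrow> ('a \<Rightarrow> complex) \<Rightarrow> ('a \<Rightarrow> complex \<Rightarrow> real) \<Rightarrow> bool" where
  "complete_riemannian_metric S z h \<longleftrightarrow> Metric_space.mcomplete S (riemannian_dist S z h)"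

end

theory Submission
  imports Defs
begin

text \<open>
  On every surface considered the metric is \<open>ds = \<rho>(z) |dz|\<close> for one function \<open>\<rho>\<close> on the punctured
  plane: a constant \<open>K \<ge> 1\<close>, contributed by the constant \<open>g\<^sub>i\<close>, times
  \<open>(1 + |w|\<^sup>2)\<close> to the power \<open>M/2\<close>, divided by \<open>\<Prod>|w - \<alpha>\<^sub>j|\<close>, where \<open>M\<close> is the sum of the exponents
  \<open>m\<^sub>i\<close> of the nonconstant \<open>g\<^sub>i\<close>. The plane domain with the identity and its universal cover are both
  connected covering spaces of the punctured plane, so the completeness statement is proved once, for
  an arbitrary connected covering space.

  Near a puncture \<open>\<rho>\<close> behaves like \<open>1/|w - \<alpha>\<^sub>j|\<close>, and near infinity like \<open>|w|\<close> to the power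
  \<open>M - (p - 1)\<close>. Hence the punctures are always infinitely far away, and infinity is
  so iff \<open>M - (p - 1) \<ge> -1\<close>, that is \<open>p \<le> 2 + M\<close>.

  If \<open>p \<le> 2 + M\<close>, there is one \<open>c > 0\<close> with \<open>c / |w - \<alpha>\<^sub>j| \<le> \<rho>(w)\<close> on the whole domain and for all \<open>j\<close>
  (\<open>product_density_ge_inverse_dist\<close>). The length of a path then bounds the variation of
  \<open>c log |w - \<alpha>\<^sub>j|\<close> along it, which keeps paths of bounded length from a fixed point inside a compact
  subset of the punctured plane. This suffices for completeness
  (\<open>complete_if_bounded_paths_end_in_compact\<close>): the projection of a Cauchy sequence has a cluster
  point \<open>w\<close>, and near \<open>w\<close>, where \<open>\<rho>\<close> is bounded above and below, the tail of the sequence is trapped in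
  a single sheet of the covering.

  If \<open>p \<ge> 3 + M\<close>, then \<open>\<rho>(w) \<le> B/|w|\<^sup>2\<close> far out, so the lift of a real ray to infinity has finite
  length. The lifts of the points \<open>R 2\<^sup>n\<close> of the ray form a Cauchy sequence without limit, because
  convergence in the distance implies convergence of the projections
  (\<open>not_complete_if_short_segments_to_infinity\<close>).

  The coordinate \<open>z\<close> takes exactly the values in the punctured plane, so it omits exactly \<open>p\<close> points of
  the sphere; the sharp examples are those with \<open>p = 2 + M\<close>.
\<close>

section \<open>Lengths of plane paths for a conformal density\<close>

text \<open>
  The length of a plane path for the metric \<open>\<rho> |dw|\<close>. Since \<open>z \<circ> \<gamma>\<close> determines the length of a path \<open>\<gamma>\<close> on
  the covering surface, all estimates of length take place in the plane.
\<close>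

definition conf_length :: "(complex \<Rightarrow> real) \<Rightarrow> (real \<Rightarrow> complex) \<Rightarrow> ennreal" where
  "conf_length \<rho> g =
     (\<integral>\<^sup>+t\<in>{0..1}. ennreal (\<rho> (g t) * cmod (vector_derivative g (at t))) \<partial>lborel)"

text \<open>
  The end points are put into the exceptional set because the two-sided derivative there depends on
  values of \<open>g\<close> outside of the unit interval.
\<close>

lemma valid_path_has_vector_derivative:
  fixes g :: "real \<Rightarrow> 'a::real_normed_vector"
  assumes "valid_path g"
  obtains F where "finite F" "{0, 1} \<subseteq> F"
    "\<And>t. t \<in> {0..1} - F \<Longrightarrow> (g has_vector_derivative vector_derivative g (at t)) (at t)"
    "continuous_on ({0..1} - F) (\<lambda>t. vector_derivative g (at t))"
proof -
  obtain F where "finite F" and C1: "g C1_differentiable_on ({0..1} - F)"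
    using assms unfolding valid_path_def piecewise_C1_differentiable_on_def by blast
  then have "g C1_differentiable_on ({0..1} - (F \<union> {0, 1}))"
    by (rule_tac C1_differentiable_on_subset) auto
  with \<open>finite F\<close> show ?thesis
    unfolding C1_differentiable_on_eq by (intro that[of "F \<union> {0, 1}"]) (auto simp: vector_derivative_works)
qed

lemma vector_derivative_cong_interior:
  fixes f g :: "real \<Rightarrow> 'a::real_normed_vector"
  assumes eq: "\<And>t. t \<in> {0..1} \<Longrightarrow> f t = g t" and "0 < t" "t < 1"
  shows "vector_derivative f (at t) = vector_derivative g (at t)"
proof (rule vector_derivative_cong_eq)
  have "eventually (\<lambda>s. s \<in> {0<..<1}) (nhds t)"
    using assms by (intro eventually_nhds_in_open) auto
  then show "eventually (\<lambda>s. s \<in> UNIV \<longrightarrow> f s = g s) (nhds t)"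
    by eventually_elim (use eq in auto)
qed auto

lemma valid_path_cong:
  fixes f g :: "real \<Rightarrow> 'a::real_normed_vector"
  assumes eq: "\<And>t. t \<in> {0..1} \<Longrightarrow> f t = g t" and g: "valid_path g"
  shows "valid_path f"
proof -
  obtain F where F: "finite F" "{0, 1} \<subseteq> F"
    "\<And>t. t \<in> {0..1} - F \<Longrightarrow> (g has_vector_derivative vector_derivative g (at t)) (at t)"
    "continuous_on ({0..1} - F) (\<lambda>t. vector_derivative g (at t))"
    using valid_path_has_vector_derivative[OF g] by metis
  have "continuous_on {0..1} g"
    using g by (simp add: valid_path_def piecewise_C1_differentiable_on_def)
  then have "continuous_on {0..1} f"
    by (rule continuous_on_eq) (simp add: eq)
  moreover have "f C1_differentiable_on ({0..1} - F)"
    unfolding C1_differentiable_on_def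
  proof (intro exI conjI ballI)
    show "(f has_vector_derivative vector_derivative g (at t)) (at t)" if "t \<in> {0..1} - F" for t
    proof (rule has_vector_derivative_transform_within_open[OF F(3)[OF that], of "{0<..<1}"])
      show "t \<in> {0<..<1}"
        using that F(2) by (cases "t = 0"; cases "t = 1") auto
    qed (auto simp: eq)
  qed (use F in auto)
  ultimately show ?thesis
    using F(1) by (auto simp: valid_path_def piecewise_C1_differentiable_on_def)
qed

lemma conf_length_cong:
  assumes eq: "\<And>t. t \<in> {0..1} \<Longrightarrow> f t = g t"
  shows "conf_length \<rho> f = conf_length \<rho> g"
  unfolding conf_length_def
proof (rule nn_integral_cong_AE)
  have "AE t in lborel. t \<noteq> 0 \<and> t \<noteq> (1::real)"
    by (intro AE_conjI AE_lborel_singleton)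
  then show "AE t in lborel.
      ennreal (\<rho> (f t) * cmod (vector_derivative f (at t))) * indicator {0..1} t =
      ennreal (\<rho> (g t) * cmod (vector_derivative g (at t))) * indicator {0..1} t"
    by eventually_elim
      (use vector_derivative_cong_interior[OF eq] in \<open>auto simp: eq indicator_def\<close>)
qed

lemma AE_notin_finite:
  assumes "finite (F :: real set)" shows "AE t in lborel. t \<notin> F"
  using assms
proof (induction rule: finite_induct)
  case (insert x F)
  from insert.IH AE_lborel_singleton[of x] show ?case
    by eventually_elim auto
qed simp

text \<open>
  Measurability is what makes the substitution rule and the additivity of the integral applicable: the
  integrand is continuous off a finite set, where its values do not matter.
\<close>

lemma conf_length_integrand_measurable:
  assumes g: "valid_path g" "path_image g \<subseteq> P" and \<rho>: "continuous_on P \<rho>"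
  shows "(\<lambda>t. \<rho> (g t) * cmod (vector_derivative g (at t)) * indicator {0..1} t) \<in> borel_measurable borel"
proof -
  obtain F where F: "finite F"
    "continuous_on ({0..1} - F) (\<lambda>t. vector_derivative g (at t))"
    using valid_path_has_vector_derivative[OF g(1)] by metis
  let ?f = "\<lambda>t. \<rho> (g t) * cmod (vector_derivative g (at t))"
  have cont: "continuous_on ({0..1} - F) g"
    using g(1) by (meson Diff_subset continuous_on_subset piecewise_C1_differentiable_on_def valid_path_def)
  have "continuous_on ({0..1} - F) ?f"
    using g(2) by (intro continuous_intros F(2) continuous_on_compose2[OF \<rho> cont]) (auto simp: path_image_def)
  then have "(\<lambda>t. indicator ({0..1} - F) t *\<^sub>R ?f t) \<in> borel_measurable borel"
    using F(1) by (intro borel_measurable_continuous_on_indicator) (auto intro!: sets.Diff simp: finite_imp_closed)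
  then show ?thesis
    by (rule measurable_discrete_difference[where X = F])
      (use F(1) in \<open>auto simp: indicator_def uncountable_infinite countable_finite\<close>)
qed

lemma conf_length_integrand_measurable_ennreal:
  assumes "valid_path g" "path_image g \<subseteq> P" "continuous_on P \<rho>"
  shows "(\<lambda>t. ennreal (\<rho> (g t) * cmod (vector_derivative g (at t))) * indicator {0..1} t)
    \<in> borel_measurable borel"
proof -
  have "(\<lambda>t. ennreal (\<rho> (g t) * cmod (vector_derivative g (at t))) * indicator {0..1} t) =
      (\<lambda>t. ennreal (\<rho> (g t) * cmod (vector_derivative g (at t)) * indicator {0..1} t))"
    by (auto simp: indicator_def)
  then show ?thesis
    using conf_length_integrand_measurable[OF assms] by simp
qed

lemma conf_length_affine:
  assumes "valid_path g" "path_image g \<subseteq> P" "continuous_on P \<rho>" and c: "c \<noteq> 0"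
  shows "conf_length \<rho> g = (\<integral>\<^sup>+s. ennreal (\<bar>c\<bar> * (\<rho> (g (t + c * s)) *
      cmod (vector_derivative g (at (t + c * s))))) * indicator {0..1} (t + c * s) \<partial>lborel)"
proof -
  have "conf_length \<rho> g = \<bar>c\<bar> * (\<integral>\<^sup>+s. ennreal (\<rho> (g (t + c * s)) *
      cmod (vector_derivative g (at (t + c * s)))) * indicator {0..1} (t + c * s) \<partial>lborel)"
    unfolding conf_length_def
    by (rule nn_integral_real_affine[OF conf_length_integrand_measurable_ennreal[OF assms(1-3)] c])
  also have "\<dots> = (\<integral>\<^sup>+s. \<bar>c\<bar> * (ennreal (\<rho> (g (t + c * s)) *
      cmod (vector_derivative g (at (t + c * s)))) * indicator {0..1} (t + c * s)) \<partial>lborel)"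
  proof (rule nn_integral_cmult[symmetric])
    have "(\<lambda>s. t + c * s) \<in> borel_measurable borel" by measurable
    from measurable_compose[OF this conf_length_integrand_measurable_ennreal[OF assms(1-3)]]
    show "(\<lambda>s. ennreal (\<rho> (g (t + c * s)) * cmod (vector_derivative g (at (t + c * s))))
      * indicator {0..1} (t + c * s)) \<in> borel_measurable lborel" by simp
  qed
  finally show ?thesis
    by (simp add: ennreal_mult' mult.assoc)
qed

lemma has_vector_derivative_affine:
  fixes g :: "real \<Rightarrow> complex"
  assumes "(g has_vector_derivative g') (at (t + c * s))"
  shows "((\<lambda>s. g (t + c * s)) has_vector_derivative c *\<^sub>R g') (at s)"
proof -
  have "((\<lambda>s. t + c * s) has_real_derivative c) (at s)"
    by (auto intro!: derivative_eq_intros)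
  from vector_diff_chain_at[OF this[unfolded has_real_derivative_iff_has_vector_derivative] assms]
  show ?thesis by (simp add: o_def)
qed

lemma finite_affine_vimage:
  assumes "finite (F :: real set)" "c \<noteq> 0" shows "finite {s. t + c * s \<in> F}"
proof -
  have "inj (\<lambda>s. t + c * s)" using \<open>c \<noteq> 0\<close> by (simp add: inj_on_def)
  from finite_vimageI[OF assms(1) this] show ?thesis by (simp add: vimage_def)
qed

lemma conf_length_reversepath:
  assumes "valid_path g" "path_image g \<subseteq> P" "continuous_on P \<rho>"
  shows "conf_length \<rho> (reversepath g) = conf_length \<rho> g"
proof -
  obtain F where F: "finite F"
    "\<And>t. t \<in> {0..1} - F \<Longrightarrow> (g has_vector_derivative vector_derivative g (at t)) (at t)"
    using valid_path_has_vector_derivative[OF assms(1)] by metis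
  have "AE s in lborel. s \<notin> {s. 1 + (-1) * s \<in> F}"
    by (intro AE_notin_finite finite_affine_vimage F) simp
  then have "AE s in lborel.
      ennreal (\<rho> (reversepath g s) * cmod (vector_derivative (reversepath g) (at s))) * indicator {0..1} s =
      ennreal (\<bar>-1\<bar> * (\<rho> (g (1 + (-1) * s)) * cmod (vector_derivative g (at (1 + (-1) * s))))) *
        indicator {0..1} (1 + (-1) * s)"
  proof eventually_elim
    case (elim s)
    show ?case
    proof (cases "s \<in> {0..1}")
      case True
      have "((\<lambda>s. g (1 + (-1) * s)) has_vector_derivative
          (-1) *\<^sub>R vector_derivative g (at (1 + (-1) * s))) (at s)"
        using True elim by (intro has_vector_derivative_affine F) auto
      then have "vector_derivative (reversepath g) (at s) = - vector_derivative g (at (1 - s))"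
        by (intro vector_derivative_at) (simp add: reversepath_def[abs_def])
      with True show ?thesis
        by (simp add: reversepath_def norm_minus_cancel indicator_def)
    qed (auto simp: indicator_def)
  qed
  then show ?thesis
    unfolding conf_length_affine[OF assms, of "-1" 1, simplified]
    unfolding conf_length_def by (intro nn_integral_cong_AE) simp
qed

text \<open>
  Each half of the joined path is an affine reparametrisation of one of the two paths, so
  \<open>conf_length_affine\<close> applies to both.
\<close>

lemma conf_length_joinpaths_le:
  assumes g1: "valid_path g1" "path_image g1 \<subseteq> P" and g2: "valid_path g2" "path_image g2 \<subseteq> P"
    and \<rho>: "continuous_on P \<rho>"
  shows "conf_length \<rho> (g1 +++ g2) \<le> conf_length \<rho> g1 + conf_length \<rho> g2"
proof -
  obtain F1 where F1: "finite F1"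
    "\<And>t. t \<in> {0..1} - F1 \<Longrightarrow> (g1 has_vector_derivative vector_derivative g1 (at t)) (at t)"
    using valid_path_has_vector_derivative[OF g1(1)] by metis
  obtain F2 where F2: "finite F2"
    "\<And>t. t \<in> {0..1} - F2 \<Longrightarrow> (g2 has_vector_derivative vector_derivative g2 (at t)) (at t)"
    using valid_path_has_vector_derivative[OF g2(1)] by metis
  let ?f = "\<lambda>c t g s. ennreal (\<bar>c\<bar> * (\<rho> (g (t + c * s)) * cmod (vector_derivative g (at (t + c * s))))) *
        indicator {0..1} (t + c * s :: real)"
  have meas: "?f 2 t g \<in> borel_measurable borel" if "valid_path g" "path_image g \<subseteq> P" for t g
  proof -
    have "(\<lambda>s. t + 2 * s) \<in> borel_measurable borel" by measurable
    from measurable_compose[OF this conf_length_integrand_measurable[OF that \<rho>]]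
    have "(\<lambda>s. ennreal (2 * (\<rho> (g (t + 2 * s)) * cmod (vector_derivative g (at (t + 2 * s)))
      * indicator {0..1} (t + 2 * s)))) \<in> borel_measurable borel" by measurable
    also have "(\<lambda>s. ennreal (2 * (\<rho> (g (t + 2 * s)) * cmod (vector_derivative g (at (t + 2 * s)))
      * indicator {0..1} (t + 2 * s)))) = ?f 2 t g" by (auto simp: indicator_def)
    finally show ?thesis .
  qed
  have "AE s in lborel. s \<notin> {s. 0 + 2 * s \<in> F1} \<union> {s. (-1) + 2 * s \<in> F2} \<union> {1/2}"
    by (intro AE_notin_finite finite_UnI finite_affine_vimage F1 F2) auto
  then have "AE s in lborel.
      ennreal (\<rho> ((g1 +++ g2) s) * cmod (vector_derivative (g1 +++ g2) (at s))) * indicator {0..1} s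
      \<le> ?f 2 0 g1 s + ?f 2 (-1) g2 s"
  proof eventually_elim
    case (elim s)
    consider "0 \<le> s" "s < 1/2" | "1/2 < s" "s \<le> 1" | "s \<notin> {0..1}"
      using elim by fastforce
    then show ?case
    proof cases
      case 1
      have "((\<lambda>s. g1 (0 + 2 * s)) has_vector_derivative 2 *\<^sub>R vector_derivative g1 (at (0 + 2 * s))) (at s)"
        using 1 elim by (intro has_vector_derivative_affine F1) auto
      then have "((g1 +++ g2) has_vector_derivative 2 *\<^sub>R vector_derivative g1 (at (0 + 2 * s))) (at s)"
        by (rule has_vector_derivative_transform_within_open[where S = "{..<1/2}"])
          (use 1 in \<open>auto simp: joinpaths_def\<close>)
      from vector_derivative_at[OF this] show ?thesis
        using 1 by (simp add: joinpaths_def mult_ac)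
    next
      case 2
      have "((\<lambda>s. g2 (-1 + 2 * s)) has_vector_derivative 2 *\<^sub>R vector_derivative g2 (at (-1 + 2 * s))) (at s)"
        using 2 elim by (intro has_vector_derivative_affine F2) auto
      then have "((g1 +++ g2) has_vector_derivative 2 *\<^sub>R vector_derivative g2 (at (-1 + 2 * s))) (at s)"
        by (rule has_vector_derivative_transform_within_open[where S = "{1/2<..}"])
          (use 2 in \<open>auto simp: joinpaths_def\<close>)
      from vector_derivative_at[OF this] show ?thesis
        using 2 by (simp add: joinpaths_def mult_ac)
    qed auto
  qed
  then have "conf_length \<rho> (g1 +++ g2) \<le> (\<integral>\<^sup>+s. ?f 2 0 g1 s + ?f 2 (-1) g2 s \<partial>lborel)"
    unfolding conf_length_def by (rule nn_integral_mono_AE)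
  also have "\<dots> = (\<integral>\<^sup>+s. ?f 2 0 g1 s \<partial>lborel) + (\<integral>\<^sup>+s. ?f 2 (-1) g2 s \<partial>lborel)"
    using meas[OF g1, of 0] meas[OF g2, of "-1"] by (intro nn_integral_add) auto
  also have "\<dots> = conf_length \<rho> g1 + conf_length \<rho> g2"
    using conf_length_affine[OF g1 \<rho>, of 2 0] conf_length_affine[OF g2 \<rho>, of 2 "-1"] by simp
  finally show ?thesis .
qed

lemma conf_length_linepath_le:
  assumes "\<And>u. u \<in> closed_segment a b \<Longrightarrow> \<rho> u \<le> C" "0 \<le> C"
  shows "conf_length \<rho> (linepath a b) \<le> ennreal (C * cmod (b - a))"
proof -
  have vd: "vector_derivative (linepath a b) (at t) = b - a" for t
    using has_vector_derivative_linepath_within vector_derivative_at by blast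
  have "conf_length \<rho> (linepath a b) \<le> (\<integral>\<^sup>+t. ennreal (C * cmod (b - a)) * indicator {0..1::real} t \<partial>lborel)"
    unfolding conf_length_def vd
    by (intro nn_integral_mono)
      (auto simp: indicator_def intro!: ennreal_leI mult_right_mono assms linepath_in_path)
  also have "\<dots> = ennreal (C * cmod (b - a))"
    by (subst nn_integral_cmult_indicator) auto
  finally show ?thesis .
qed

text \<open>
  The source of every lower bound on lengths: a function whose differential is dominated by the metric
  varies along a path by at most the length of the path, by the fundamental theorem of calculus for
  \<open>f \<circ> g\<close>. Only an initial piece \<open>{0..b}\<close> is considered, and domination is asked only at interior
  parameters, so that the bound can be used up to the moment at which the path leaves a region. The
  derivative of \<open>g\<close> may be unbounded, but there is nothing to prove if the length is infinite, and
  otherwise the integrand of the length is an integrable majorant.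
\<close>

lemma potential_difference_le_conf_length:
  fixes f :: "complex \<Rightarrow> 'b::euclidean_space"
  assumes g: "valid_path g" "path_image g \<subseteq> P" and \<rho>: "continuous_on P \<rho>"
    and pos: "\<And>w. w \<in> P \<Longrightarrow> 0 \<le> \<rho> w"
    and b: "0 \<le> b" "b \<le> 1"
    and cont: "continuous_on (g ` {0..b}) f"
    and der: "\<And>t. t \<in> {0<..<b} \<Longrightarrow> (f has_derivative f' (g t)) (at (g t))"
    and le: "\<And>t v. t \<in> {0<..<b} \<Longrightarrow> norm (f' (g t) v) \<le> \<rho> (g t) * cmod v"
  shows "ennreal (norm (f (g b) - f (g 0))) \<le> conf_length \<rho> g"
proof (cases "conf_length \<rho> g = top")
  case False
  define L where "L = enn2real (conf_length \<rho> g)"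
  have L: "conf_length \<rho> g = ennreal L" "0 \<le> L"
    using False by (simp_all add: L_def top.not_eq_extremum)
  obtain F where F: "finite F" "{0, 1} \<subseteq> F"
    "\<And>t. t \<in> {0..1} - F \<Longrightarrow> (g has_vector_derivative vector_derivative g (at t)) (at t)"
    using valid_path_has_vector_derivative[OF g(1)] by metis
  let ?G = "\<lambda>t. \<rho> (g t) * cmod (vector_derivative g (at t)) * indicator {0..1} t"
  have G0: "0 \<le> ?G t" for t
    using pos g(2) by (auto simp: indicator_def path_image_def image_subset_iff)
  have "(?G has_integral L) UNIV"
  proof (rule nn_integral_has_integral)
    show "?G \<in> borel_measurable borel"
      by (rule conf_length_integrand_measurable[OF g \<rho>])
    have "(\<integral>\<^sup>+t. ennreal (?G t) \<partial>lborel) = conf_length \<rho> g"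
      unfolding conf_length_def by (intro nn_integral_cong) (auto simp: indicator_def)
    then show "(\<integral>\<^sup>+t. ennreal (?G t) \<partial>lborel) = ennreal L"
      using L by simp
  qed (use L G0 in auto)
  then have int: "?G integrable_on UNIV" "integral UNIV ?G = L"
    by (auto simp: has_integral_iff)
  have intb: "?G integrable_on {0..b}"
    using int(1) by (metis integrable_on_subcbox interval_cbox subset_UNIV)
  have contg: "continuous_on {0..b} g"
    using g(1) b
    by (auto simp: valid_path_def piecewise_C1_differentiable_on_def intro: continuous_on_subset)
  \<comment> \<open>The derivative of \<open>f \<circ> g\<close>, set to \<open>0\<close> where it is not known to exist or to be dominated.\<close>
  let ?h = "\<lambda>t. if t \<in> F \<or> t \<notin> {0<..<b} then 0 else f' (g t) (vector_derivative g (at t))"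
  have "(?h has_integral (f (g b) - f (g 0))) {0..b}"
  proof (rule fundamental_theorem_of_calculus_interior_strong[OF F(1) b(1), where f = "\<lambda>t. f (g t)"])
    fix t assume t: "t \<in> {0<..<b} - F"
    then have fd: "(f has_derivative f' (g t)) (at (g t))"
      and gd: "(g has_vector_derivative vector_derivative g (at t)) (at t)"
      using b der F(3)[of t] by auto
    have "((f \<circ> g) has_derivative f' (g t) \<circ> (\<lambda>s. s *\<^sub>R vector_derivative g (at t))) (at t)"
      using diff_chain_at[OF gd[unfolded has_vector_derivative_def] fd] .
    moreover have "f' (g t) \<circ> (\<lambda>s. s *\<^sub>R vector_derivative g (at t)) =
        (\<lambda>s. s *\<^sub>R f' (g t) (vector_derivative g (at t)))"
      using linear_scale[OF has_derivative_linear[OF fd]] by (simp add: fun_eq_iff)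
    ultimately show "((\<lambda>t. f (g t)) has_vector_derivative ?h t) (at t)"
      using t by (simp add: has_vector_derivative_def o_def)
  next
    show "continuous_on {0..b} (\<lambda>t. f (g t))"
      by (rule continuous_on_compose2[OF cont contg]) simp
  qed
  then have "norm (f (g b) - f (g 0)) = norm (integral {0..b} ?h)" "?h integrable_on {0..b}"
    by (auto simp: has_integral_iff)
  moreover have "norm (integral {0..b} ?h) \<le> integral {0..b} ?G"
  proof (rule integral_norm_bound_integral)
    show "norm (?h t) \<le> ?G t" if "t \<in> {0..b}" for t
      using le[of t "vector_derivative g (at t)"] G0[of t] that b by (auto simp: indicator_def)
  qed fact+
  moreover have "integral {0..b} ?G \<le> integral UNIV ?G"
    using int intb G0 by (intro integral_subset_le) auto
  ultimately show ?thesis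
    unfolding L(1) by (intro ennreal_leI) (use int(2) in linarith)
qed simp

section \<open>Sheets and path lifting in covering spaces\<close>

text \<open>
  The map \<open>q\<close> is the inverse of the projection on one sheet \<open>q ` B\<close> over \<open>B\<close>. The last clause says that
  a path that lies over \<open>B\<close> cannot change sheets; it records the disjointness of the sheets in the form
  in which it is used.
\<close>

definition covering_sheet ::
    "'a::topological_space set \<Rightarrow> ('a \<Rightarrow> 'b::topological_space) \<Rightarrow> 'b set \<Rightarrow> ('b \<Rightarrow> 'a) \<Rightarrow> bool" where
  "covering_sheet S z B q \<longleftrightarrow>
     continuous_on B q \<and> (\<forall>u\<in>B. q u \<in> S \<and> z (q u) = u) \<and> openin (top_of_set S) (q ` B) \<and>
     (\<forall>\<gamma>. path \<gamma> \<and> path_image \<gamma> \<subseteq> S \<and> z ` path_image \<gamma> \<subseteq> B \<and> pathstart \<gamma> \<in> q ` B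
        \<longrightarrow> path_image \<gamma> \<subseteq> q ` B)"

lemma covering_sheetD:
  assumes "covering_sheet S z B q"
  shows "continuous_on B q" "\<And>u. u \<in> B \<Longrightarrow> q u \<in> S" "\<And>u. u \<in> B \<Longrightarrow> z (q u) = u"
    "openin (top_of_set S) (q ` B)"
  using assms by (auto simp: covering_sheet_def)

lemma covering_sheet_pathfinish:
  assumes q: "covering_sheet S z B q"
    and \<gamma>: "path \<gamma>" "path_image \<gamma> \<subseteq> S" "z ` path_image \<gamma> \<subseteq> B" "pathstart \<gamma> \<in> q ` B"
  shows "pathfinish \<gamma> = q (z (pathfinish \<gamma>))"
proof -
  have "path_image \<gamma> \<subseteq> q ` B"
    using assms unfolding covering_sheet_def by simp
  then obtain u where "u \<in> B" "pathfinish \<gamma> = q u"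
    using pathfinish_in_path_image by blast
  then show ?thesis
    using covering_sheetD(3)[OF q] by simp
qed

text \<open>
  A path over an evenly covered set stays in its sheet by connectedness: the sheet and the union of the
  other sheets cut the path into two disjoint relatively open pieces.
\<close>

lemma covering_space_evenly_covered:
  assumes cov: "covering_space S z P" and w: "w \<in> P"
  obtains T where "w \<in> T" "openin (top_of_set P) T"
    "\<And>y. y \<in> S \<Longrightarrow> z y \<in> T \<Longrightarrow> \<exists>q. covering_sheet S z T q \<and> q (z y) = y"
proof -
  obtain T V where T: "w \<in> T" "openin (top_of_set P) T"
    and V: "\<Union>V = S \<inter> z -` T" "pairwise disjnt V"
      "\<And>U. U \<in> V \<Longrightarrow> openin (top_of_set S) U" "\<And>U. U \<in> V \<Longrightarrow> \<exists>q. homeomorphism U T z q"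
    using cov w unfolding covering_space_def by metis
  show thesis
  proof (rule that[OF T])
    fix y assume "y \<in> S" "z y \<in> T"
    with V(1) obtain U where U: "U \<in> V" "y \<in> U" by blast
    from V(4)[OF U(1)] obtain q where q: "homeomorphism U T z q" by blast
    have img: "q ` T = U" by (rule homeomorphism_image2[OF q])
    have "U \<subseteq> S" by (rule openin_imp_subset[OF V(3)[OF U(1)]])
    have "path_image \<gamma> \<subseteq> U"
      if \<gamma>: "path \<gamma>" "path_image \<gamma> \<subseteq> S" "z ` path_image \<gamma> \<subseteq> T" "pathstart \<gamma> \<in> U" for \<gamma>
    proof -
      let ?W = "\<Union>(V - {U})"
      have "openin (top_of_set S) ?W"
        using V(3) by blast
      moreover have "openin (top_of_set (path_image \<gamma>)) (path_image \<gamma> \<inter> A)"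
        if "openin (top_of_set S) A" for A
        using that \<gamma>(2) unfolding openin_open by blast
      ultimately have opens: "openin (top_of_set (path_image \<gamma>)) (path_image \<gamma> \<inter> U)"
        "openin (top_of_set (path_image \<gamma>)) (path_image \<gamma> \<inter> ?W)"
        using V(3)[OF U(1)] by blast+
      have "U \<inter> U' = {}" if "U' \<in> V - {U}" for U'
        using pairwiseD[OF V(2) U(1), of U'] that by (auto simp: disjnt_def)
      then have disj: "path_image \<gamma> \<inter> U \<inter> (path_image \<gamma> \<inter> ?W) = {}"
        by blast
      have sub: "path_image \<gamma> \<subseteq> U \<union> ?W"
      proof
        fix u assume "u \<in> path_image \<gamma>"
        then have "u \<in> \<Union>V" unfolding V(1) using \<gamma>(2,3) by blast
        then show "u \<in> U \<union> ?W" by blast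
      qed
      then have "path_image \<gamma> \<subseteq> path_image \<gamma> \<inter> U \<union> path_image \<gamma> \<inter> ?W"
        by (simp add: Int_Un_distrib[symmetric])
      moreover have "path_image \<gamma> \<inter> U \<noteq> {}"
        using \<gamma>(4) pathstart_in_path_image by blast
      ultimately have "path_image \<gamma> \<inter> ?W = {}"
        using opens disj connected_path_image[OF \<gamma>(1)] unfolding connected_openin by metis
      with sub show ?thesis
        by blast
    qed
    moreover have "q u \<in> S \<and> z (q u) = u" if "u \<in> T" for u
      using homeomorphism_apply2[OF q that] img that \<open>U \<subseteq> S\<close> by blast
    ultimately have "covering_sheet S z T q"
      unfolding covering_sheet_def img using homeomorphism_cont2[OF q] V(3)[OF U(1)] by simp
    then show "\<exists>q. covering_sheet S z T q \<and> q (z y) = y"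
      using homeomorphism_apply1[OF q U(2)] by blast
  qed
qed

lemma covering_sheet_subset:
  assumes q: "covering_sheet S z T q" and cont: "continuous_on S z" and B: "B \<subseteq> T" "open B"
  shows "covering_sheet S z B q"
proof -
  note qD = covering_sheetD[OF q]
  have img: "q ` B = q ` T \<inter> (S \<inter> z -` B)"
  proof
    show "q ` B \<subseteq> q ` T \<inter> (S \<inter> z -` B)"
      using qD(2,3) B(1) by auto
    show "q ` T \<inter> (S \<inter> z -` B) \<subseteq> q ` B"
    proof
      fix y assume y: "y \<in> q ` T \<inter> (S \<inter> z -` B)"
      then obtain u where "u \<in> T" "y = q u" by blast
      moreover from this have "u \<in> B" using y qD(3) by auto
      ultimately show "y \<in> q ` B" by blast
    qed
  qed
  have open': "openin (top_of_set S) (q ` B)"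
    unfolding img by (intro openin_Int qD(4) continuous_openin_preimage_gen[OF cont B(2)])
  have "path_image \<gamma> \<subseteq> q ` B"
    if \<gamma>: "path \<gamma>" "path_image \<gamma> \<subseteq> S" "z ` path_image \<gamma> \<subseteq> B" "pathstart \<gamma> \<in> q ` B" for \<gamma>
  proof -
    have "z ` path_image \<gamma> \<subseteq> T" "pathstart \<gamma> \<in> q ` T"
      using \<gamma>(3,4) B(1) by auto
    then have "path_image \<gamma> \<subseteq> q ` T"
      using q \<gamma>(1,2) unfolding covering_sheet_def by simp
    then show ?thesis
      unfolding img using \<gamma>(2,3) by auto
  qed
  with open' show ?thesis
    using qD(2,3) B(1) continuous_on_subset[OF qD(1) B(1)] unfolding covering_sheet_def by auto
qed

text \<open>
  Path lifting for covering spaces that carry no structure besides their topology. The parameters up to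
  which a lift from \<open>x\<close> exists form a set to which connectedness of the unit interval applies: near any
  parameter a lift can be extended through a sheet, and shortened by restriction.
\<close>

lemma covering_space_path_lifting:
  fixes z :: "'a::topological_space \<Rightarrow> 'b::topological_space"
  assumes cov: "covering_space S z P" and g: "path g" "path_image g \<subseteq> P"
    and x: "x \<in> S" "z x = pathstart g"
  obtains \<gamma> where "path \<gamma>" "path_image \<gamma> \<subseteq> S" "pathstart \<gamma> = x" "\<And>t. t \<in> {0..1} \<Longrightarrow> z (\<gamma> t) = g t"
proof -
  define Q where "Q t \<longleftrightarrow> (\<exists>h. continuous_on {0..t} h \<and> h ` {0..t} \<subseteq> S \<and> h 0 = x \<and>
      (\<forall>s\<in>{0..t}. z (h s) = g s))" for t :: real
  have gc: "continuous_on {0..1} g" using g(1) by (simp add: path_def)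
  have gP: "g t \<in> P" if "t \<in> {0..1}" for t using g(2) that by (auto simp: path_image_def)
  have "Q 1"
  proof (rule connected_induction_simple[of "{0..1::real}" 0 1 Q])
    show "Q 0" unfolding Q_def using x by (intro exI[of _ "\<lambda>_. x"]) (auto simp: pathstart_def)
    fix t0 :: real assume t0: "t0 \<in> {0..1}"
    obtain T where T: "g t0 \<in> T" "openin (top_of_set P) T"
      "\<And>y. y \<in> S \<Longrightarrow> z y \<in> T \<Longrightarrow> \<exists>q. covering_sheet S z T q \<and> q (z y) = y"
      using covering_space_evenly_covered[OF cov gP[OF t0]] by metis
    have "openin (top_of_set {0..1}) ({0..1} \<inter> g -` T)"
      using gP by (intro continuous_openin_preimage[OF gc _ T(2)]) auto
    with T(1) t0 obtain e where e: "0 < e" "\<And>t. t \<in> {0..1} \<Longrightarrow> dist t t0 < e \<Longrightarrow> g t \<in> T"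
      unfolding openin_euclidean_subtopology_iff
      by (metis IntD2 IntI vimage_eq)
    have ext: "Q t'" if t: "t \<in> {0..1} \<inter> ball t0 e" and t': "t' \<in> {0..1} \<inter> ball t0 e" and "Q t" for t t'
    proof -
      obtain h where h: "continuous_on {0..t} h" "h ` {0..t} \<subseteq> S" "h 0 = x" "\<forall>s\<in>{0..t}. z (h s) = g s"
        using \<open>Q t\<close> by (auto simp: Q_def)
      show ?thesis
      proof (cases "t' \<le> t")
        case True
        then show ?thesis unfolding Q_def
          using h by (intro exI[of _ h] conjI) (auto intro: continuous_on_subset)
      next
        case False
        have T': "g s \<in> T" if "s \<in> {t..t'}" for s
          using that t t' by (intro e(2)) (auto simp: dist_real_def)
        have "h t \<in> S" "z (h t) = g t" using h(2,4) t by auto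
        then obtain q where q: "covering_sheet S z T q" and qt: "q (g t) = h t"
          using T(3)[of "h t"] T'[of t] False by auto
        let ?h = "\<lambda>s. if s \<le> t then h s else q (g s)"
        have "continuous_on {t..t'} (\<lambda>s. q (g s))"
        proof (rule continuous_on_compose2[OF covering_sheetD(1)[OF q]])
          show "continuous_on {t..t'} g" using t t' by (intro continuous_on_subset[OF gc]) auto
        qed (use T' in blast)
        then have "continuous_on ({0..t} \<union> {t..t'}) ?h"
          by (intro continuous_on_cases h(1)) (use qt in auto)
        also have "{0..t} \<union> {t..t'} = {0..t'}" using t False by auto
        finally have "continuous_on {0..t'} ?h" .
        moreover have "?h ` {0..t'} \<subseteq> S" "\<forall>s\<in>{0..t'}. z (?h s) = g s"
          using h(2,4) covering_sheetD(2,3)[OF q] T' by (auto simp: image_subset_iff)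
        moreover have "?h 0 = x" using h(3) t by simp
        ultimately show ?thesis unfolding Q_def by blast
      qed
    qed
    have "openin (top_of_set {0..1}) ({0..1} \<inter> ball t0 e)" "t0 \<in> {0..1} \<inter> ball t0 e"
      using e(1) t0 by auto
    with ext show "\<exists>T. openin (top_of_set {0..1}) T \<and> t0 \<in> T \<and> (\<forall>x\<in>T. \<forall>y\<in>T. Q x \<longrightarrow> Q y)"
      by blast
  qed auto
  then obtain h where h: "continuous_on {0..1} h" "h ` {0..1} \<subseteq> S" "h 0 = x" "\<forall>s\<in>{0..1}. z (h s) = g s"
    unfolding Q_def by blast
  show thesis
    by (rule that[of h]) (use h in \<open>simp_all add: path_def path_image_def pathstart_def\<close>)
qed

section \<open>The distance of a conformal metric on a covering\<close>

text \<open>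
  A connected covering surface of a plane domain \<open>P\<close>, with the metric \<open>\<rho> |dw|\<close> of \<open>P\<close> pulled back by
  the projection. The total space is an arbitrary topological space, so its points can be told apart
  only by means of the sheets.
\<close>

locale conformal_covering =
  fixes S :: "'a::topological_space set" and z :: "'a \<Rightarrow> complex"
    and P :: "complex set" and \<rho> :: "complex \<Rightarrow> real"
  assumes covering: "covering_space S z P"
    and open_base: "open P"
    and connected_cover: "connected S"
    and continuous_density: "continuous_on P \<rho>"
    and density_pos: "\<And>w. w \<in> P \<Longrightarrow> 0 < \<rho> w"
begin

abbreviation metric_form :: "'a \<Rightarrow> complex \<Rightarrow> real" where
  "metric_form \<equiv> \<lambda>x v. (\<rho> (z x) * cmod v)\<^sup>2"

abbreviation D :: "'a \<Rightarrow> 'a \<Rightarrow> real" where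
  "D \<equiv> riemannian_dist S z metric_form"

abbreviation paths :: "'a \<Rightarrow> 'a \<Rightarrow> (real \<Rightarrow> 'a) set" where
  "paths \<equiv> piecewise_C1_paths S z"

lemma projection_mem: "x \<in> S \<Longrightarrow> z x \<in> P"
  using covering_space_imp_surjective[OF covering] by blast

lemma pathsD:
  assumes "\<gamma> \<in> paths x y"
  shows "path \<gamma>" "path_image \<gamma> \<subseteq> S" "\<gamma> 0 = x" "\<gamma> 1 = y" "x \<in> S" "y \<in> S"
    "valid_path (z \<circ> \<gamma>)" "path_image (z \<circ> \<gamma>) \<subseteq> P"
proof -
  show "path \<gamma>" and im: "path_image \<gamma> \<subseteq> S" and "\<gamma> 0 = x" "\<gamma> 1 = y" "valid_path (z \<circ> \<gamma>)"
    using assms by (auto simp: piecewise_C1_paths_def pathstart_def pathfinish_def)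
  with pathstart_in_path_image[of \<gamma>] pathfinish_in_path_image[of \<gamma>] show "x \<in> S" "y \<in> S"
    by (auto simp: pathstart_def pathfinish_def)
  show "path_image (z \<circ> \<gamma>) \<subseteq> P"
    using im projection_mem by (auto simp: path_image_compose)
qed

lemma curve_length_eq:
  assumes "\<gamma> \<in> paths x y"
  shows "curve_length z metric_form \<gamma> = conf_length \<rho> (z \<circ> \<gamma>)"
proof -
  have "0 \<le> \<rho> (z (\<gamma> t))" if "t \<in> {0..1}" for t
    using pathsD(8)[OF assms] density_pos[of "z (\<gamma> t)"] that
    by (auto simp: path_image_def image_subset_iff)
  then show ?thesis
    unfolding curve_length_def conf_length_def
    by (intro nn_integral_cong) (auto simp: indicator_def real_sqrt_abs)
qed

lemma riemannian_dist_eq: "D x y = enn2real (INF \<gamma>\<in>paths x y. conf_length \<rho> (z \<circ> \<gamma>))"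
  unfolding riemannian_dist_def by (simp add: curve_length_eq cong: INF_cong)

lemma riemannian_dist_nonneg: "0 \<le> D x y"
  by (simp add: riemannian_dist_def)

lemma riemannian_dist_le:
  assumes "\<gamma> \<in> paths x y" "conf_length \<rho> (z \<circ> \<gamma>) \<le> ennreal L" "0 \<le> L"
  shows "D x y \<le> L"
  unfolding riemannian_dist_eq
  by (intro enn2real_leI INF_lower2[OF assms(1)] assms)

lemma reversepath_mem_paths:
  assumes "\<gamma> \<in> paths x y" shows "reversepath \<gamma> \<in> paths y x"
proof -
  have "z \<circ> reversepath \<gamma> = reversepath (z \<circ> \<gamma>)"
    by (simp add: reversepath_def fun_eq_iff)
  with assms show ?thesis by (auto simp: piecewise_C1_paths_def)
qed

lemma conf_length_reverse:
  assumes "\<gamma> \<in> paths x y" shows "conf_length \<rho> (z \<circ> reversepath \<gamma>) = conf_length \<rho> (z \<circ> \<gamma>)"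
proof -
  have "z \<circ> reversepath \<gamma> = reversepath (z \<circ> \<gamma>)"
    by (simp add: reversepath_def fun_eq_iff)
  then show ?thesis
    using conf_length_reversepath[OF pathsD(7,8)[OF assms] continuous_density] by simp
qed

lemma join_mem_paths:
  assumes 1: "\<gamma>1 \<in> paths x y" and 2: "\<gamma>2 \<in> paths y w"
  shows "\<gamma>1 +++ \<gamma>2 \<in> paths x w"
    and "conf_length \<rho> (z \<circ> (\<gamma>1 +++ \<gamma>2)) \<le> conf_length \<rho> (z \<circ> \<gamma>1) + conf_length \<rho> (z \<circ> \<gamma>2)"
proof -
  have eq: "z \<circ> (\<gamma>1 +++ \<gamma>2) = (z \<circ> \<gamma>1) +++ (z \<circ> \<gamma>2)"
    by (simp add: joinpaths_def fun_eq_iff)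
  have "pathfinish (z \<circ> \<gamma>1) = pathstart (z \<circ> \<gamma>2)"
    using pathsD(4)[OF 1] pathsD(3)[OF 2] by (simp add: pathfinish_def pathstart_def)
  then show "\<gamma>1 +++ \<gamma>2 \<in> paths x w"
    using 1 2 eq by (auto simp: piecewise_C1_paths_def valid_path_join path_image_join)
  show "conf_length \<rho> (z \<circ> (\<gamma>1 +++ \<gamma>2)) \<le> conf_length \<rho> (z \<circ> \<gamma>1) + conf_length \<rho> (z \<circ> \<gamma>2)"
    unfolding eq
    by (rule conf_length_joinpaths_le[OF pathsD(7,8)[OF 1] pathsD(7,8)[OF 2] continuous_density])
qed

text \<open>
  All upper bounds on distances come from lifted segments.
\<close>

lemma lifted_linepath:
  assumes \<gamma>: "path \<gamma>" "path_image \<gamma> \<subseteq> S"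
    and lift: "\<And>t. t \<in> {0..1} \<Longrightarrow> z (\<gamma> t) = linepath a b t"
    and le: "\<And>u. u \<in> closed_segment a b \<Longrightarrow> \<rho> u \<le> C" and "0 \<le> C"
  shows "\<gamma> \<in> paths (\<gamma> 0) (\<gamma> 1)" "conf_length \<rho> (z \<circ> \<gamma>) \<le> ennreal (C * dist a b)"
    "D (\<gamma> 0) (\<gamma> 1) \<le> C * dist a b"
proof -
  have "valid_path (z \<circ> \<gamma>)"
    by (rule valid_path_cong[of _ "linepath a b"]) (auto simp: lift)
  then show mem: "\<gamma> \<in> paths (\<gamma> 0) (\<gamma> 1)"
    using \<gamma> by (simp add: piecewise_C1_paths_def pathstart_def pathfinish_def)
  have "conf_length \<rho> (z \<circ> \<gamma>) = conf_length \<rho> (linepath a b)"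
    by (rule conf_length_cong) (simp add: lift)
  also have "\<dots> \<le> ennreal (C * cmod (b - a))"
    by (rule conf_length_linepath_le[OF le \<open>0 \<le> C\<close>])
  also have "cmod (b - a) = dist a b"
    by (simp add: dist_norm norm_minus_commute)
  finally show len: "conf_length \<rho> (z \<circ> \<gamma>) \<le> ennreal (C * dist a b)" .
  show "D (\<gamma> 0) (\<gamma> 1) \<le> C * dist a b"
    by (rule riemannian_dist_le[OF mem len]) (use \<open>0 \<le> C\<close> in simp)
qed

text \<open>
  Around every point of the base there is an evenly covered disc on which the metric is comparable to
  the Euclidean one.
\<close>

lemma chart:
  assumes w: "w \<in> P"
  obtains r c C where "0 < r" "0 < c" "0 < C" "ball w r \<subseteq> P"
    "\<And>u. u \<in> ball w r \<Longrightarrow> c \<le> \<rho> u" "\<And>u. u \<in> ball w r \<Longrightarrow> \<rho> u \<le> C"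
    "\<And>y. y \<in> S \<Longrightarrow> z y \<in> ball w r \<Longrightarrow> \<exists>q. covering_sheet S z (ball w r) q \<and> q (z y) = y"
proof -
  obtain T where T: "w \<in> T" "openin (top_of_set P) T"
    "\<And>y. y \<in> S \<Longrightarrow> z y \<in> T \<Longrightarrow> \<exists>q. covering_sheet S z T q \<and> q (z y) = y"
    using covering_space_evenly_covered[OF covering w] by metis
  have "open T" "T \<subseteq> P"
    using T(2) open_base openin_open_trans openin_imp_subset by blast+
  obtain r where r: "0 < r" "cball w r \<subseteq> T"
    using open_contains_cball \<open>open T\<close> T(1) by blast
  have "cball w r \<subseteq> P" using r(2) \<open>T \<subseteq> P\<close> by blast
  then have cont: "continuous_on (cball w r) \<rho>"
    using continuous_density continuous_on_subset by blast
  have ne: "cball w r \<noteq> {}" using r(1) by simp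
  obtain a where a: "a \<in> cball w r" "\<And>u. u \<in> cball w r \<Longrightarrow> \<rho> a \<le> \<rho> u"
    using continuous_attains_inf[OF compact_cball ne cont] by blast
  obtain b where b: "b \<in> cball w r" "\<And>u. u \<in> cball w r \<Longrightarrow> \<rho> u \<le> \<rho> b"
    using continuous_attains_sup[OF compact_cball ne cont] by blast
  show thesis
  proof (rule that[OF r(1)])
    show "0 < \<rho> a" "0 < \<rho> b"
      using a(1) b(1) \<open>cball w r \<subseteq> P\<close> by (auto intro: density_pos)
    show "ball w r \<subseteq> P" using \<open>cball w r \<subseteq> P\<close> by auto
    fix y assume y: "y \<in> S" "z y \<in> ball w r"
    with r(2) have "z y \<in> T" by auto
    from T(3)[OF y(1) this] obtain q where q: "covering_sheet S z T q" "q (z y) = y" by blast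
    have "ball w r \<subseteq> T" using r(2) by auto
    from covering_sheet_subset[OF q(1) covering_space_imp_continuous[OF covering] this open_ball] q(2)
    show "\<exists>q. covering_sheet S z (ball w r) q \<and> q (z y) = y" by blast
  qed (use a(2) b(2) in auto)
qed

lemma sheet_lipschitz:
  assumes q: "covering_sheet S z (ball w r) q"
    and C: "\<And>u. u \<in> ball w r \<Longrightarrow> \<rho> u \<le> C" "0 \<le> C"
    and ab: "a \<in> ball w r" "b \<in> ball w r"
  shows "\<exists>\<gamma>\<in>paths (q a) (q b). conf_length \<rho> (z \<circ> \<gamma>) \<le> ennreal (C * dist a b)"
    "D (q a) (q b) \<le> C * dist a b"
proof -
  note qD = covering_sheetD[OF q]
  have seg: "closed_segment a b \<subseteq> ball w r"
    using ab by (simp add: closed_segment_subset)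
  have "path (q \<circ> linepath a b)"
    by (rule path_continuous_image) (use qD(1) seg continuous_on_subset in auto)
  moreover have "path_image (q \<circ> linepath a b) \<subseteq> S"
    using qD(2) seg by (auto simp: path_image_compose)
  moreover have "z ((q \<circ> linepath a b) t) = linepath a b t" if "t \<in> {0..1}" for t
    using qD(3)[of "linepath a b t"] seg linepath_in_path[OF that, of a b] by auto
  moreover have "\<rho> u \<le> C" if "u \<in> closed_segment a b" for u
    using that seg C(1) by blast
  ultimately have "q \<circ> linepath a b \<in> paths (q a) (q b)"
    "conf_length \<rho> (z \<circ> (q \<circ> linepath a b)) \<le> ennreal (C * dist a b)"
    "D (q a) (q b) \<le> C * dist a b"
    using lifted_linepath[of "q \<circ> linepath a b" a b C] C(2) by (simp_all add: linepath_0' linepath_1')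
  then show "\<exists>\<gamma>\<in>paths (q a) (q b). conf_length \<rho> (z \<circ> \<gamma>) \<le> ennreal (C * dist a b)"
    "D (q a) (q b) \<le> C * dist a b" by blast+
qed

text \<open>
  The infimum that defines the distance has to be finite, since \<^const>\<open>enn2real\<close> maps an infinite one to
  \<open>0\<close>. Being joined by a path of finite length is an equivalence relation, and its classes are open
  because a sheet over a disc is joined to its centre by lifted segments; so connectedness leaves only
  one class.
\<close>

lemma ex_path_finite_length:
  assumes "x \<in> S" "y \<in> S"
  shows "\<exists>\<gamma>\<in>paths x y. conf_length \<rho> (z \<circ> \<gamma>) < top"
proof (rule connected_equivalence_relation[OF connected_cover assms])
  fix x y assume "\<exists>\<gamma>\<in>paths x y. conf_length \<rho> (z \<circ> \<gamma>) < top"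
  then show "\<exists>\<gamma>\<in>paths y x. conf_length \<rho> (z \<circ> \<gamma>) < top"
    using reversepath_mem_paths conf_length_reverse by metis
next
  fix x y w
  assume "\<exists>\<gamma>\<in>paths x y. conf_length \<rho> (z \<circ> \<gamma>) < top" "\<exists>\<gamma>\<in>paths y w. conf_length \<rho> (z \<circ> \<gamma>) < top"
  then obtain \<gamma>1 \<gamma>2 where 1: "\<gamma>1 \<in> paths x y" "conf_length \<rho> (z \<circ> \<gamma>1) < top"
    and 2: "\<gamma>2 \<in> paths y w" "conf_length \<rho> (z \<circ> \<gamma>2) < top"
    by blast
  have "conf_length \<rho> (z \<circ> (\<gamma>1 +++ \<gamma>2)) < top"
    by (rule order_le_less_trans[OF join_mem_paths(2)[OF 1(1) 2(1)]]) (use 1(2) 2(2) in simp)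
  with join_mem_paths(1)[OF 1(1) 2(1)] show "\<exists>\<gamma>\<in>paths x w. conf_length \<rho> (z \<circ> \<gamma>) < top"
    by blast
next
  fix a assume a: "a \<in> S"
  obtain r c C where r: "0 < r" "0 < c" "0 < C" "ball (z a) r \<subseteq> P"
    "\<And>u. u \<in> ball (z a) r \<Longrightarrow> c \<le> \<rho> u" "\<And>u. u \<in> ball (z a) r \<Longrightarrow> \<rho> u \<le> C"
    and sheet: "\<And>y. y \<in> S \<Longrightarrow> z y \<in> ball (z a) r \<Longrightarrow> \<exists>q. covering_sheet S z (ball (z a) r) q \<and> q (z y) = y"
    using chart[OF projection_mem[OF a]] by metis
  have za: "z a \<in> ball (z a) r" using r(1) by simp
  from sheet[OF a za] obtain q where q: "covering_sheet S z (ball (z a) r) q" "q (z a) = a"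
    by blast
  have "\<exists>\<gamma>\<in>paths a x. conf_length \<rho> (z \<circ> \<gamma>) < top" if "x \<in> q ` ball (z a) r" for x
  proof -
    from that obtain u where u: "u \<in> ball (z a) r" "x = q u" by blast
    from sheet_lipschitz(1)[OF q(1) r(6) less_imp_le[OF r(3)] za u(1)]
    obtain \<gamma> where "\<gamma> \<in> paths (q (z a)) (q u)" "conf_length \<rho> (z \<circ> \<gamma>) \<le> ennreal (C * dist (z a) u)"
      by blast
    then show ?thesis
      using order_le_less_trans[OF _ ennreal_less_top] q(2) u(2) by metis
  qed
  moreover have "a \<in> q ` ball (z a) r" using imageI[OF za, of q] q(2) by simp
  ultimately show "\<exists>T. openin (top_of_set S) T \<and> a \<in> T \<and> (\<forall>x\<in>T. \<exists>\<gamma>\<in>paths a x. conf_length \<rho> (z \<circ> \<gamma>) < top)"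
    using covering_sheetD(4)[OF q(1)] by blast
qed

lemma riemannian_dist_less:
  assumes "x \<in> S" "y \<in> S" "D x y < L"
  obtains \<gamma> where "\<gamma> \<in> paths x y" "conf_length \<rho> (z \<circ> \<gamma>) < ennreal L"
proof -
  let ?I = "INF \<gamma>\<in>paths x y. conf_length \<rho> (z \<circ> \<gamma>)"
  have "?I < top"
    using ex_path_finite_length[OF assms(1,2)] by (auto simp: INF_less_iff)
  then have "?I = ennreal (D x y)"
    by (simp add: riemannian_dist_eq)
  also have "\<dots> < ennreal L"
    using assms(3) le_less_trans[OF riemannian_dist_nonneg assms(3)] by (intro ennreal_lessI)
  finally show thesis
    using that by (auto simp: INF_less_iff)
qed

text \<open>
  A path that leaves the disc of radius \<open>r\<close> has already length \<open>c * r\<close> at the first moment at which it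
  does so.
\<close>

lemma short_path_stays_in_ball:
  assumes g: "valid_path g" "path_image g \<subseteq> P"
    and c: "0 < c" "\<And>u. u \<in> P \<Longrightarrow> dist (g 0) u < r \<Longrightarrow> c \<le> \<rho> u"
    and len: "conf_length \<rho> g < ennreal (c * r)"
  shows "path_image g \<subseteq> ball (g 0) r" "ennreal (c * dist (g 0) (g 1)) \<le> conf_length \<rho> g"
proof -
  have le: "ennreal (c * dist (g 0) (g b)) \<le> conf_length \<rho> g"
    if b: "0 \<le> b" "b \<le> 1" and near: "\<And>t. t \<in> {0<..<b} \<Longrightarrow> dist (g 0) (g t) < r" for b
  proof -
    have "ennreal (norm (c *\<^sub>R g b - c *\<^sub>R g 0)) \<le> conf_length \<rho> g"
    proof (rule potential_difference_le_conf_length[OF g continuous_density _ b, where f' = "\<lambda>_ v. c *\<^sub>R v"])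
      show "norm (c *\<^sub>R v) \<le> \<rho> (g t) * cmod v" if "t \<in> {0<..<b}" for t v
        using c(2)[of "g t"] near[OF that] that b g(2) c(1)
        by (auto simp: path_image_def image_subset_iff intro!: mult_right_mono)
    qed (auto intro!: continuous_intros derivative_eq_intros less_imp_le[OF density_pos])
    also have "norm (c *\<^sub>R g b - c *\<^sub>R g 0) = c * dist (g 0) (g b)"
      using c(1) by (simp add: scaleR_right_diff_distrib[symmetric] dist_norm norm_minus_commute)
    finally show ?thesis .
  qed
  have near: "dist (g 0) (g t) < r" if t: "t \<in> {0..1}" for t
  proof (rule ccontr)
    \<comment> \<open>The minimum \<open>t0\<close> of this compact set is the first exit time.\<close>
    define T where "T = {t \<in> {0..1}. r \<le> dist (g 0) (g t)}"
    assume "\<not> dist (g 0) (g t) < r"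
    then have "t \<in> T" using t by (simp add: T_def)
    have "continuous_on {0..1} g"
      using g(1) by (simp add: valid_path_def piecewise_C1_differentiable_on_def)
    then have "closed T"
      unfolding T_def by (intro continuous_on_closed_Collect_le continuous_intros) auto
    moreover have "bounded T"
      by (rule bounded_subset[OF bounded_closed_interval[of 0 "1::real"]]) (auto simp: T_def)
    ultimately have "compact T"
      by (simp add: compact_eq_bounded_closed)
    from compact_attains_inf[OF this] \<open>t \<in> T\<close>
    obtain t0 where t0: "t0 \<in> T" "\<And>s. s \<in> T \<Longrightarrow> t0 \<le> s"
      by blast
    have "ennreal (c * dist (g 0) (g t0)) \<le> conf_length \<rho> g"
    proof (rule le)
      show "dist (g 0) (g s) < r" if "s \<in> {0<..<t0}" for s
        using t0(2)[of s] t0(1) that by (force simp: T_def)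
    qed (use t0(1) in \<open>auto simp: T_def\<close>)
    moreover have "ennreal (c * r) \<le> ennreal (c * dist (g 0) (g t0))"
      using t0(1) c(1) by (intro ennreal_leI mult_left_mono) (auto simp: T_def)
    ultimately show False using len by (meson leD order_trans)
  qed
  then show "path_image g \<subseteq> ball (g 0) r" by (auto simp: path_image_def)
  show "ennreal (c * dist (g 0) (g 1)) \<le> conf_length \<rho> g"
    by (rule le) (auto intro: near)
qed

text \<open>
  Short paths from \<open>x\<close> stay over the disc, where the metric dominates \<open>c\<close> times the Euclidean one. This
  makes the projections of a convergent sequence converge.
\<close>

lemma dist_projection_le:
  assumes x: "x \<in> S" and y: "y \<in> S"
    and c: "0 < c" "\<And>u. u \<in> P \<Longrightarrow> dist (z x) u < r \<Longrightarrow> c \<le> \<rho> u"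
    and less: "D x y < c * r"
  shows "c * dist (z x) (z y) \<le> D x y"
proof (rule dense_ge_bounded[OF less])
  fix L assume L: "D x y < L" "L < c * r"
  obtain \<gamma> where \<gamma>: "\<gamma> \<in> paths x y" "conf_length \<rho> (z \<circ> \<gamma>) < ennreal L"
    using riemannian_dist_less[OF x y L(1)] .
  have "0 \<le> L" using L(1) riemannian_dist_nonneg[of x y] by simp
  have "ennreal (c * dist ((z \<circ> \<gamma>) 0) ((z \<circ> \<gamma>) 1)) \<le> conf_length \<rho> (z \<circ> \<gamma>)"
  proof (rule short_path_stays_in_ball(2)[OF pathsD(7,8)[OF \<gamma>(1)] c(1)])
    show "conf_length \<rho> (z \<circ> \<gamma>) < ennreal (c * r)"
      using \<gamma>(2) L(2) by (meson ennreal_leI less_imp_le order_less_le_trans)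
  qed (use c(2) pathsD(3)[OF \<gamma>(1)] in auto)
  also note less_imp_le[OF \<gamma>(2)]
  finally show "c * dist (z x) (z y) \<le> L"
    using pathsD(3,4)[OF \<gamma>(1)] \<open>0 \<le> L\<close> by (simp add: ennreal_le_iff)
qed

section \<open>Criteria for completeness and incompleteness\<close>

text \<open>
  A point at small distance is reached by a path that stays over the disc, hence in the same sheet.
\<close>

lemma near_point_in_sheet:
  assumes q: "covering_sheet S z (ball w r) q" and y: "y \<in> S" "q (z y) = y"
    and y': "y' \<in> S" and c: "0 < c" "\<And>u. u \<in> ball w r \<Longrightarrow> c \<le> \<rho> u"
    and s: "0 < s" "ball (z y) s \<subseteq> ball w r" and less: "D y y' < c * s"
  shows "q (z y') = y'" "z y' \<in> ball w r"
proof -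
  obtain \<gamma> where \<gamma>: "\<gamma> \<in> paths y y'" "conf_length \<rho> (z \<circ> \<gamma>) < ennreal (c * s)"
    using riemannian_dist_less[OF y(1) y' less] .
  note \<gamma>D = pathsD[OF \<gamma>(1)]
  have "path_image (z \<circ> \<gamma>) \<subseteq> ball ((z \<circ> \<gamma>) 0) s"
  proof (rule short_path_stays_in_ball(1)[OF \<gamma>D(7,8) c(1) _ \<gamma>(2)])
    show "c \<le> \<rho> u" if "dist ((z \<circ> \<gamma>) 0) u < s" for u
      using that s(2) \<gamma>D(3) by (intro c(2)) auto
  qed
  then have im: "z ` path_image \<gamma> \<subseteq> ball w r"
    using s(2) \<gamma>D(3) by (auto simp: path_image_compose)
  have fin: "pathfinish \<gamma> = y'" using \<gamma>D(4) by (simp add: pathfinish_def)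
  with im show zy': "z y' \<in> ball w r"
    using pathfinish_in_path_image[of \<gamma>] by auto
  have "z y \<in> ball w r" using s centre_in_ball[of "z y" s] by blast
  then have "pathstart \<gamma> \<in> q ` ball w r"
    using y(2) \<gamma>D(3) imageI[of "z y" "ball w r" q] by (simp add: pathstart_def)
  from covering_sheet_pathfinish[OF q \<gamma>D(1,2) im this] show "q (z y') = y'"
    by (simp add: fin)
qed

text \<open>
  Symmetry and the triangle inequality come from reversing and joining paths. If \<open>D x y = 0\<close>, then \<open>y\<close>
  is in the sheet of \<open>x\<close> and has the same projection as \<open>x\<close>.
\<close>

lemma Metric_space_riemannian_dist: "Metric_space S D"
proof
  fix x y show "0 \<le> D x y" by (rule riemannian_dist_nonneg)
next
  have le: "D x y \<le> D y x" for x y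
  proof -
    have "(INF \<gamma>\<in>paths x y. conf_length \<rho> (z \<circ> \<gamma>)) = (INF \<gamma>\<in>paths y x. conf_length \<rho> (z \<circ> \<gamma>))"
      by (intro antisym INF_greatest)
        (metis INF_lower conf_length_reverse reversepath_mem_paths)+
    then show ?thesis by (simp add: riemannian_dist_eq)
  qed
  fix x y show "D x y = D y x" by (intro antisym le)
next
  fix x y assume x: "x \<in> S" and y: "y \<in> S"
  show "D x y = 0 \<longleftrightarrow> x = y"
  proof
    assume "x = y"
    have "D x x \<le> \<rho> (z x) * dist (z x) (z x)"
      using lifted_linepath(3)[of "\<lambda>_. x" "z x" "z x" "\<rho> (z x)"] x density_pos[OF projection_mem[OF x]]
      by (simp add: path_image_def path_def image_subset_iff linepath_refl)
    then show "D x y = 0"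
      using riemannian_dist_nonneg[of x x] \<open>x = y\<close> by simp
  next
    assume 0: "D x y = 0"
    obtain r c C where r: "0 < r" "0 < c" "\<And>u. u \<in> ball (z x) r \<Longrightarrow> c \<le> \<rho> u"
      and sheet: "\<And>y. y \<in> S \<Longrightarrow> z y \<in> ball (z x) r \<Longrightarrow> \<exists>q. covering_sheet S z (ball (z x) r) q \<and> q (z y) = y"
      using chart[OF projection_mem[OF x]] by metis
    obtain q where q: "covering_sheet S z (ball (z x) r) q" "q (z x) = x"
      using sheet[OF x] r(1) by auto
    have less: "D x y < c * r" using 0 r by simp
    have "q (z y) = y"
      by (rule near_point_in_sheet(1)[OF q(1) x q(2) y r(2,3) r(1) _ less]) auto
    moreover have "c * dist (z x) (z y) \<le> D x y"
      by (rule dist_projection_le[OF x y r(2) _ less]) (use r(3) in auto)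
    then have "z x = z y" using 0 r(2) by (simp add: mult_le_0_iff)
    ultimately show "x = y" using q(2) by metis
  qed
next
  fix x y w assume x: "x \<in> S" and y: "y \<in> S" and w: "w \<in> S"
  show "D x w \<le> D x y + D y w"
  proof (rule field_le_epsilon)
    fix e :: real assume "0 < e"
    obtain \<gamma>1 where 1: "\<gamma>1 \<in> paths x y" "conf_length \<rho> (z \<circ> \<gamma>1) < ennreal (D x y + e / 2)"
      using riemannian_dist_less[OF x y, of "D x y + e / 2"] \<open>0 < e\<close> by auto
    obtain \<gamma>2 where 2: "\<gamma>2 \<in> paths y w" "conf_length \<rho> (z \<circ> \<gamma>2) < ennreal (D y w + e / 2)"
      using riemannian_dist_less[OF y w, of "D y w + e / 2"] \<open>0 < e\<close> by auto
    have "conf_length \<rho> (z \<circ> (\<gamma>1 +++ \<gamma>2)) \<le> ennreal (D x y + e / 2) + ennreal (D y w + e / 2)"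
      by (rule order_trans[OF join_mem_paths(2)[OF 1(1) 2(1)]])
        (intro add_mono less_imp_le 1(2) 2(2))
    also have "\<dots> = ennreal (D x y + D y w + e)"
      using riemannian_dist_nonneg[of x y] riemannian_dist_nonneg[of y w] \<open>0 < e\<close>
      by (simp flip: ennreal_plus)
    finally show "D x w \<le> D x y + D y w + e"
      using riemannian_dist_nonneg[of x y] riemannian_dist_nonneg[of y w] \<open>0 < e\<close>
      by (intro riemannian_dist_le[OF join_mem_paths(1)[OF 1(1) 2(1)]]) auto
  qed
qed

sublocale riemannian: Metric_space S D
  by (rule Metric_space_riemannian_dist)

text \<open>
  The hypothesis is that paths of bounded length in the base from a given point do not approach its
  boundary. The projections of a Cauchy sequence then have a cluster point \<open>w\<close> in the base. As soon as
  one member of the tail is over the disc of half the radius around \<open>w\<close> and the tail is closer together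
  than the scale of that disc, the whole tail is in one sheet \<open>q\<close>, and the subsequence converges to
  \<open>q w\<close>.
\<close>

lemma complete_if_bounded_paths_end_in_compact:
  assumes bounded_paths: "\<And>w L. w \<in> P \<Longrightarrow> \<exists>K. compact K \<and> K \<subseteq> P \<and>
    (\<forall>g. valid_path g \<and> path_image g \<subseteq> P \<and> g 0 = w \<and> conf_length \<rho> g < ennreal L \<longrightarrow> g 1 \<in> K)"
  shows "complete_riemannian_metric S z metric_form"
  unfolding complete_riemannian_metric_def riemannian.mcomplete_def
proof (intro allI impI)
  fix \<sigma> assume cauchy: "riemannian.MCauchy \<sigma>"
  then have \<sigma>S: "\<sigma> n \<in> S" for n by (auto simp: riemannian.MCauchy_def)
  have small: "\<exists>N. \<forall>n n'. N \<le> n \<longrightarrow> N \<le> n' \<longrightarrow> D (\<sigma> n) (\<sigma> n') < e" if "0 < e" for e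
    using cauchy that by (simp add: riemannian.MCauchy_def)
  obtain N where N: "\<And>n n'. n \<ge> N \<Longrightarrow> n' \<ge> N \<Longrightarrow> D (\<sigma> n) (\<sigma> n') < 1"
    using small[of 1] by auto
  obtain K where K: "compact K" "K \<subseteq> P"
    "\<And>g. valid_path g \<Longrightarrow> path_image g \<subseteq> P \<Longrightarrow> g 0 = z (\<sigma> N) \<Longrightarrow> conf_length \<rho> g < ennreal 1 \<Longrightarrow> g 1 \<in> K"
    using bounded_paths[OF projection_mem[OF \<sigma>S[of N]], of 1] by metis
  have inK: "z (\<sigma> (N + n)) \<in> K" for n
  proof -
    obtain \<gamma> where \<gamma>: "\<gamma> \<in> paths (\<sigma> N) (\<sigma> (N + n))" "conf_length \<rho> (z \<circ> \<gamma>) < ennreal 1"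
      using riemannian_dist_less[OF \<sigma>S \<sigma>S N[of N "N + n"]] by auto
    show ?thesis
      using K(3)[OF pathsD(7,8)[OF \<gamma>(1)] _ \<gamma>(2)] pathsD(3,4)[OF \<gamma>(1)] by simp
  qed
  obtain w k where w: "w \<in> K" and k: "strict_mono (k :: nat \<Rightarrow> nat)"
    and lim: "((\<lambda>n. z (\<sigma> (N + n))) \<circ> k) \<longlonglongrightarrow> w"
    using seq_compactE[OF compact_imp_seq_compact[OF K(1)], of "\<lambda>n. z (\<sigma> (N + n))"] inK by metis
  have "w \<in> P" using w K(2) by blast
  then obtain r c C where r: "0 < r" "0 < c" "0 < C" "\<And>u. u \<in> ball w r \<Longrightarrow> c \<le> \<rho> u"
      "\<And>u. u \<in> ball w r \<Longrightarrow> \<rho> u \<le> C"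
    and sheet: "\<And>y. y \<in> S \<Longrightarrow> z y \<in> ball w r \<Longrightarrow> \<exists>q. covering_sheet S z (ball w r) q \<and> q (z y) = y"
    using chart by metis
  have "0 < c * (r / 2)" using r by simp
  from small[OF this] obtain N2
    where N2: "\<And>n n'. n \<ge> N2 \<Longrightarrow> n' \<ge> N2 \<Longrightarrow> D (\<sigma> n) (\<sigma> n') < c * (r / 2)"
    by blast
  obtain N1 where N1: "\<And>m. m \<ge> N1 \<Longrightarrow> dist (z (\<sigma> (N + k m))) w < r / 2"
    using lim r(1) unfolding lim_sequentially o_def by (meson half_gt_zero)
  define y where "y = \<sigma> (N + k (max N1 N2))"
  have km: "m \<le> k m" for m using k by (rule seq_suble)
  have yS: "y \<in> S" and ydist: "dist (z y) w < r / 2"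
    using \<sigma>S N1[of "max N1 N2"] by (auto simp: y_def)
  then have "z y \<in> ball w r" using r(1) by (simp add: dist_commute)
  then obtain q where q: "covering_sheet S z (ball w r) q" "q (z y) = y"
    using sheet[OF yS] by blast
  have ball_y: "ball (z y) (r / 2) \<subseteq> ball w r"
  proof
    fix u assume "u \<in> ball (z y) (r / 2)"
    then show "u \<in> ball w r"
      using ydist dist_triangle[of w u "z y"] by (simp add: dist_commute)
  qed
  have tail: "q (z (\<sigma> n)) = \<sigma> n" "z (\<sigma> n) \<in> ball w r" if "n \<ge> N2" for n
  proof -
    have "D y (\<sigma> n) < c * (r / 2)"
      unfolding y_def by (rule N2[OF _ that]) (use km[of "max N1 N2"] in linarith)
    from near_point_in_sheet[OF q(1) yS q(2) \<sigma>S r(2,4) half_gt_zero[OF r(1)] ball_y this]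
    show "q (z (\<sigma> n)) = \<sigma> n" "z (\<sigma> n) \<in> ball w r" by auto
  qed
  have w_ball: "w \<in> ball w r" using r(1) by simp
  have qw: "q w \<in> S" by (rule covering_sheetD(2)[OF q(1) w_ball])
  have "(\<lambda>m. D (\<sigma> (N + k m)) (q w)) \<longlonglongrightarrow> 0"
  proof (rule Lim_null_comparison)
    have "D (\<sigma> (N + k m)) (q w) \<le> C * dist (z (\<sigma> (N + k m))) w" if "m \<ge> N2" for m
    proof -
      have "N + k m \<ge> N2" using km[of m] that by linarith
      note t = tail[OF this]
      from sheet_lipschitz(2)[OF q(1) r(5) less_imp_le[OF r(3)] t(2) w_ball] show ?thesis
        by (simp add: t(1))
    qed
    then show "\<forall>\<^sub>F m in sequentially. norm (D (\<sigma> (N + k m)) (q w)) \<le> C * dist (z (\<sigma> (N + k m))) w"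
      using riemannian_dist_nonneg by (auto simp: eventually_sequentially)
    have "(\<lambda>m. C * dist (z (\<sigma> (N + k m))) w) \<longlonglongrightarrow> C * dist w w"
      using lim by (intro tendsto_intros) (simp_all add: o_def)
    then show "(\<lambda>m. C * dist (z (\<sigma> (N + k m))) w) \<longlonglongrightarrow> 0" by simp
  qed
  then have "limitin riemannian.mtopology (\<sigma> \<circ> (\<lambda>m. N + k m)) (q w) sequentially"
    unfolding riemannian.limitin_metric_dist_null using qw \<sigma>S by (simp add: o_def)
  moreover have "strict_mono (\<lambda>m. N + k m)"
    using k by (simp add: strict_mono_def)
  ultimately have "limitin riemannian.mtopology \<sigma> (q w) sequentially"
    using riemannian.MCauchy_convergent_subsequence[OF cauchy] by blast
  then show "\<exists>x. limitin riemannian.mtopology \<sigma> x sequentially" by blast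
qed

text \<open>
  Lifting the segments one after the other gives points \<open>\<sigma> n\<close> over \<open>w n\<close> whose successive distances are
  dominated by a geometric series. A limit of this Cauchy sequence would project to a limit of \<open>w\<close>,
  which is impossible because \<open>w\<close> tends to infinity.
\<close>

lemma not_complete_if_short_segments_to_infinity:
  assumes segment: "\<And>n. closed_segment (w n) (w (Suc n)) \<subseteq> P"
    and density: "\<And>n u. u \<in> closed_segment (w n) (w (Suc n)) \<Longrightarrow> \<rho> u \<le> b n"
    and short: "\<And>n. b n * dist (w n) (w (Suc n)) \<le> B / 2 ^ n"
    and infinity: "filterlim w at_infinity sequentially"
  shows "\<not> complete_riemannian_metric S z metric_form"
proof
  assume complete: "complete_riemannian_metric S z metric_form"
  have wP: "w n \<in> P" for n using segment by (auto simp: subset_iff)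
  have b0: "0 \<le> b n" for n
    using density_pos[OF wP[of n]] density[of "w n" n] by simp
  have B0: "0 \<le> B"
    using short[of 0] mult_nonneg_nonneg[OF b0[of 0] zero_le_dist[of "w 0" "w (Suc 0)"]] by simp
  have step: "\<exists>y. y \<in> S \<and> z y = w (Suc n) \<and> D x y \<le> B / 2 ^ n" if x: "x \<in> S" "z x = w n" for x n
  proof -
    have zx: "z x = pathstart (linepath (w n) (w (Suc n)))" using x(2) by simp
    obtain \<gamma> where \<gamma>: "path \<gamma>" "path_image \<gamma> \<subseteq> S" "pathstart \<gamma> = x"
        "\<And>t. t \<in> {0..1} \<Longrightarrow> z (\<gamma> t) = linepath (w n) (w (Suc n)) t"
      using covering_space_path_lifting[OF covering path_linepath _ x(1) zx] segment by auto
    have "D (\<gamma> 0) (\<gamma> 1) \<le> b n * dist (w n) (w (Suc n))"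
      by (rule lifted_linepath(3)[OF \<gamma>(1,2,4) density b0])
    with short[of n] have "D x (\<gamma> 1) \<le> B / 2 ^ n"
      using \<gamma>(3) by (simp add: pathstart_def)
    moreover have "\<gamma> 1 \<in> S" using \<gamma>(2) by (auto simp: path_image_def image_subset_iff)
    moreover have "z (\<gamma> 1) = w (Suc n)" using \<gamma>(4)[of 1] by (simp add: linepath_1')
    ultimately show ?thesis by blast
  qed
  obtain x0 where x0: "x0 \<in> S" "z x0 = w 0"
    using wP[of 0] covering_space_imp_surjective[OF covering] by auto
  have "\<exists>\<sigma>. \<forall>n. (\<sigma> n \<in> S \<and> z (\<sigma> n) = w n) \<and> D (\<sigma> n) (\<sigma> (Suc n)) \<le> B / 2 ^ n"
  proof (rule dependent_nat_choice)
    show "\<exists>x. x \<in> S \<and> z x = w 0" using x0 by blast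
    show "\<exists>y. (y \<in> S \<and> z y = w (Suc n)) \<and> D x y \<le> B / 2 ^ n" if "x \<in> S \<and> z x = w n" for x n
      using step that by blast
  qed
  then obtain \<sigma> where \<sigma>: "\<And>n. \<sigma> n \<in> S \<and> z (\<sigma> n) = w n" "\<And>n. D (\<sigma> n) (\<sigma> (Suc n)) \<le> B / 2 ^ n"
    by blast
  have tail: "D (\<sigma> m) (\<sigma> n) \<le> 2 * B / 2 ^ m - 2 * B / 2 ^ n" if "m \<le> n" for m n
    using that
  proof (induction n rule: dec_induct)
    case base
    show ?case using \<sigma>(1) by (simp add: riemannian.mdist_zero)
  next
    case (step n)
    have "D (\<sigma> m) (\<sigma> (Suc n)) \<le> D (\<sigma> m) (\<sigma> n) + D (\<sigma> n) (\<sigma> (Suc n))"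
      using \<sigma>(1) by (intro riemannian.triangle) auto
    moreover have "2 * B / 2 ^ Suc n = 2 * B / 2 ^ n - B / 2 ^ n" by (simp add: field_simps)
    ultimately show ?case using step.IH \<sigma>(2)[of n] by linarith
  qed
  have "riemannian.MCauchy \<sigma>"
    unfolding riemannian.MCauchy_def
  proof (intro conjI allI impI)
    show "range \<sigma> \<subseteq> S" using \<sigma>(1) by auto
    fix e :: real assume "0 < e"
    have "(\<lambda>n. 2 * B / 2 ^ n) \<longlonglongrightarrow> 0"
      by (rule LIMSEQ_divide_realpow_zero) simp
    from order_tendstoD(2)[OF this \<open>0 < e\<close>]
    obtain N where N: "\<And>n. n \<ge> N \<Longrightarrow> 2 * B / 2 ^ n < e"
      by (auto simp: eventually_sequentially)
    have le: "D (\<sigma> m) (\<sigma> n) < e" if "N \<le> m" "m \<le> n" for m n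
    proof -
      have "0 \<le> 2 * B / 2 ^ n" using B0 by simp
      with tail[OF that(2)] N[OF that(1)] show ?thesis by linarith
    qed
    have "D (\<sigma> m) (\<sigma> n) < e" if "N \<le> m" "N \<le> n" for m n
      using le[of m n] le[of n m] that riemannian.commute by (metis nle_le)
    then show "\<exists>N. \<forall>n n'. N \<le> n \<longrightarrow> N \<le> n' \<longrightarrow> D (\<sigma> n) (\<sigma> n') < e" by blast
  qed
  with complete obtain x where "limitin riemannian.mtopology \<sigma> x sequentially"
    unfolding complete_riemannian_metric_def riemannian.mcomplete_def by blast
  then have x: "x \<in> S" and conv: "(\<lambda>n. D (\<sigma> n) x) \<longlonglongrightarrow> 0"
    unfolding riemannian.limitin_metric_dist_null by auto
  obtain r c C where r: "0 < r" "0 < c" "\<And>u. u \<in> ball (z x) r \<Longrightarrow> c \<le> \<rho> u"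
    using chart[OF projection_mem[OF x]] by metis
  have "\<forall>\<^sub>F n in sequentially. D (\<sigma> n) x < c * r"
    using order_tendstoD(2)[OF conv, of "c * r"] r by simp
  moreover have "\<forall>\<^sub>F n in sequentially. norm (w n) \<ge> norm (z x) + r"
    using filterlim_at_infinity_imp_norm_at_top[OF infinity] by (simp add: filterlim_at_top)
  ultimately have "\<forall>\<^sub>F n in sequentially. False"
  proof eventually_elim
    case (elim n)
    have less: "D x (\<sigma> n) < c * r" using elim(1) riemannian.commute by metis
    have "c * dist (z x) (z (\<sigma> n)) \<le> D x (\<sigma> n)"
      by (rule dist_projection_le[OF x _ r(2) _ less]) (use \<sigma>(1) r(3) in auto)
    with less have "c * dist (z x) (z (\<sigma> n)) < c * r" by linarith
    then have "dist (z x) (w n) < r" using r(2) \<sigma>(1) by simp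
    then have "norm (w n) < norm (z x) + r"
      using norm_triangle_ineq2[of "w n" "z x"] by (simp add: dist_norm norm_minus_commute)
    with elim(2) show False by linarith
  qed
  then show False by simp
qed

end

section \<open>Bounds for the density of the product metric\<close>

text \<open>
  The parameter \<open>K\<close> collects the constant factors of the metric, and \<open>M\<close> is the total exponent of
  \<open>1 + |w|\<^sup>2\<close> in the squared metric.
\<close>

definition product_density :: "real \<Rightarrow> nat \<Rightarrow> (nat \<Rightarrow> complex) \<Rightarrow> nat \<Rightarrow> complex \<Rightarrow> real" where
  "product_density K M \<alpha> p w = K * sqrt (1 + (cmod w)\<^sup>2) ^ M / (\<Prod>j = 1..p - 1. cmod (w - \<alpha> j))"

lemma ds2_eq_product_density:
  assumes I: "I \<subseteq> {1..n}"
  shows "ds2 n m (Gmap I c z) (omega \<alpha> p z) =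
    (\<lambda>x v. (product_density (sqrt (\<Prod>i\<in>{1..n} - I. (1 + (cmod (c i))\<^sup>2) ^ m i)) (\<Sum>i\<in>I. m i) \<alpha> p (z x) * cmod v)\<^sup>2)"
proof (intro ext)
  fix x v
  let ?R = "\<Prod>i\<in>{1..n} - I. (1 + (cmod (c i))\<^sup>2) ^ m i" and ?s = "1 + (cmod (z x))\<^sup>2"
  have "(\<Prod>i = 1..n. (1 + (cmod (Gmap I c z i x))\<^sup>2) ^ m i) =
      (\<Prod>i\<in>{1..n} - I. (1 + (cmod (Gmap I c z i x))\<^sup>2) ^ m i) * (\<Prod>i\<in>I. (1 + (cmod (Gmap I c z i x))\<^sup>2) ^ m i)"
    by (rule prod.subset_diff[OF I]) simp
  also have "\<dots> = ?R * (\<Prod>i\<in>I. ?s ^ m i)"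
    by (intro arg_cong2[of _ _ _ _ "(*)"] prod.cong) (auto simp: Gmap_def)
  also have "(\<Prod>i\<in>I. ?s ^ m i) = ?s ^ (\<Sum>i\<in>I. m i)"
    by (simp add: power_sum)
  finally have prod: "(\<Prod>i = 1..n. (1 + (cmod (Gmap I c z i x))\<^sup>2) ^ m i) = ?R * ?s ^ (\<Sum>i\<in>I. m i)" .
  define R where "R = ?R"
  have "0 \<le> R" unfolding R_def by (intro prod_nonneg) auto
  have s: "(sqrt ?s ^ M)\<^sup>2 = ?s ^ M" for M
    by (simp add: power_mult[symmetric] mult.commute[of M 2]) (simp add: power_mult)
  show "ds2 n m (Gmap I c z) (omega \<alpha> p z) x v =
      (product_density (sqrt ?R) (\<Sum>i\<in>I. m i) \<alpha> p (z x) * cmod v)\<^sup>2"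
    unfolding ds2_def prod product_density_def omega_def R_def[symmetric]
    using \<open>0 \<le> R\<close> by (simp add: power_mult_distrib power_divide s norm_divide prod_norm)
qed

lemma sum_cmod_ge:
  fixes \<alpha> :: "nat \<Rightarrow> complex"
  assumes "j \<in> {1..p - 1}" shows "cmod (\<alpha> j) \<le> (\<Sum>i = 1..p - 1. cmod (\<alpha> i))"
  by (rule member_le_sum) (use assms in auto)

text \<open>
  With \<open>s = sqrt (1 + |w|\<^sup>2)\<close> every factor satisfies \<open>|w - \<alpha>\<^sub>i| \<le> A s\<close>. After multiplication by
  \<open>|w - \<alpha>\<^sub>j|\<close>, only \<open>p - 2\<close> factors remain in the denominator of the density, and the power \<open>M \<ge> p - 2\<close> of
  \<open>s\<close> in the numerator compensates for them.
\<close>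

lemma product_density_ge_inverse_dist:
  assumes p: "p \<le> M + 2" and K: "1 \<le> K"
  obtains c where "0 < c"
    "\<And>w j. w \<in> punctured_plane \<alpha> p \<Longrightarrow> j \<in> {1..p - 1} \<Longrightarrow> c / cmod (w - \<alpha> j) \<le> product_density K M \<alpha> p w"
proof -
  define A where "A = 1 + (\<Sum>i = 1..p - 1. cmod (\<alpha> i))"
  have "1 \<le> A" by (simp add: A_def sum_nonneg)
  show thesis
  proof (rule that[of "1 / A ^ (p - 2)"])
    show "0 < 1 / A ^ (p - 2)" using \<open>1 \<le> A\<close> by simp
    fix w j assume w: "w \<in> punctured_plane \<alpha> p" and j: "j \<in> {1..p - 1}"
    define s where "s = sqrt (1 + (cmod w)\<^sup>2)"
    have s1: "1 \<le> s" by (simp add: s_def)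
    have ws: "cmod w \<le> s" unfolding s_def by (rule real_le_rsqrt) simp
    let ?Q = "\<Prod>i\<in>{1..p - 1} - {j}. cmod (w - \<alpha> i)"
    have "cmod (w - \<alpha> i) \<le> A * s" if "i \<in> {1..p - 1}" for i
    proof -
      have "cmod (w - \<alpha> i) \<le> cmod w + cmod (\<alpha> i)" by (rule norm_triangle_ineq4)
      also have "\<dots> \<le> s + (A - 1) * s"
        using ws sum_cmod_ge[OF that, of \<alpha>] mult_left_mono[OF s1, of "A - 1"] \<open>1 \<le> A\<close>
        by (simp add: A_def)
      finally show ?thesis by (simp add: algebra_simps)
    qed
    then have "?Q \<le> (\<Prod>i\<in>{1..p - 1} - {j}. A * s)"
      by (intro prod_mono) auto
    also have "\<dots> = A ^ (p - 2) * s ^ (p - 2)"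
      using j by (simp add: card_Diff_singleton power_mult_distrib numeral_2_eq_2)
    also have "\<dots> \<le> A ^ (p - 2) * s ^ M"
      using \<open>1 \<le> A\<close> s1 p by (intro mult_left_mono power_increasing) auto
    finally have Q: "?Q \<le> A ^ (p - 2) * s ^ M" .
    have pos: "0 < cmod (w - \<alpha> i)" if "i \<in> {1..p - 1}" for i
      using w that by (auto simp: punctured_plane_def)
    then have "0 < ?Q" by (intro prod_pos) auto
    have "1 * ?Q \<le> K * (A ^ (p - 2) * s ^ M)"
      using K Q \<open>0 < ?Q\<close> by (intro mult_mono) auto
    then have "1 / A ^ (p - 2) \<le> K * s ^ M / ?Q"
      using \<open>0 < ?Q\<close> \<open>1 \<le> A\<close> by (simp add: divide_le_eq le_divide_eq field_simps)
    then have "1 / A ^ (p - 2) / cmod (w - \<alpha> j) \<le> K * s ^ M / ?Q / cmod (w - \<alpha> j)"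
      by (intro divide_right_mono) auto
    also have "\<dots> = product_density K M \<alpha> p w"
      using j by (simp add: product_density_def s_def prod.remove[of _ j] mult.commute)
    finally show "1 / A ^ (p - 2) / cmod (w - \<alpha> j) \<le> product_density K M \<alpha> p w" .
  qed
qed

text \<open>
  Far from the punctures each factor \<open>|u - \<alpha>\<^sub>j|\<close> is at least \<open>|u| / 2\<close>, so the density is of order
  \<open>|u|\<close> to the power \<open>M - (p - 1)\<close>, and this exponent is at most \<open>-2\<close>.
\<close>

lemma product_density_le_inverse_square:
  assumes p: "M + 3 \<le> p" and K: "0 \<le> K" and u: "1 + 2 * (\<Sum>i = 1..p - 1. cmod (\<alpha> i)) \<le> cmod u"
  shows "product_density K M \<alpha> p u \<le> K * 2 ^ (M + (p - 1)) / (cmod u)\<^sup>2"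
proof -
  define t where "t = cmod u"
  have t: "1 \<le> t" "1 + 2 * (\<Sum>i = 1..p - 1. cmod (\<alpha> i)) \<le> t"
    using u sum_nonneg[of "{1..p - 1}" "\<lambda>i. cmod (\<alpha> i)"] by (auto simp: t_def)
  have "sqrt (1 + t\<^sup>2) \<le> 2 * t"
  proof (rule real_le_lsqrt)
    have "1 \<le> t\<^sup>2" using t(1) by (rule one_le_power)
    then show "1 + t\<^sup>2 \<le> (2 * t)\<^sup>2" unfolding power_mult_distrib by simp
  qed (use t(1) in simp)
  then have num: "sqrt (1 + t\<^sup>2) ^ M \<le> (2 * t) ^ M"
    by (intro power_mono) auto
  have "(\<Prod>j = 1..p - 1. t / 2) \<le> (\<Prod>j = 1..p - 1. cmod (u - \<alpha> j))"
  proof (intro prod_mono conjI)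
    fix j assume "j \<in> {1..p - 1}"
    from sum_cmod_ge[OF this, of \<alpha>] norm_triangle_ineq2[of u "\<alpha> j"] t(2)
    show "t / 2 \<le> cmod (u - \<alpha> j)" unfolding t_def by linarith
  qed (use t(1) in auto)
  then have den: "(t / 2) ^ (p - 1) \<le> (\<Prod>j = 1..p - 1. cmod (u - \<alpha> j))"
    by simp
  have "t ^ (M + 2) \<le> t ^ (p - 1)"
    using t(1) p by (intro power_increasing) auto
  have "product_density K M \<alpha> p u \<le> K * (2 * t) ^ M / (t / 2) ^ (p - 1)"
    unfolding product_density_def t_def[symmetric]
    using num den t(1) K by (intro frac_le mult_left_mono mult_nonneg_nonneg) auto
  also have "\<dots> = K * 2 ^ (M + (p - 1)) * t ^ M / t ^ (p - 1)"
    by (simp add: power_mult_distrib power_divide power_add)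
  also have "\<dots> \<le> K * 2 ^ (M + (p - 1)) * t ^ M / t ^ (M + 2)"
    using t(1) K \<open>t ^ (M + 2) \<le> t ^ (p - 1)\<close> by (intro divide_left_mono) auto
  also have "\<dots> = K * 2 ^ (M + (p - 1)) / t\<^sup>2"
    using t(1) by (simp add: power_add power2_eq_square)
  finally show ?thesis by (simp add: t_def)
qed

text \<open>
  Here \<open>c log |w - a|\<close> is the potential: its differential has norm \<open>c / |w - a|\<close>.
\<close>

lemma log_dist_le_conf_length:
  assumes "valid_path g" "path_image g \<subseteq> P" "continuous_on P \<rho>" "\<And>w. w \<in> P \<Longrightarrow> 0 \<le> \<rho> w"
    and a: "a \<notin> P" and c: "0 \<le> c" "\<And>w. w \<in> P \<Longrightarrow> c / cmod (w - a) \<le> \<rho> w"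
  shows "ennreal (c * \<bar>ln (cmod (g 1 - a)) - ln (cmod (g 0 - a))\<bar>) \<le> conf_length \<rho> g"
proof -
  let ?f = "\<lambda>w. c * ln (cmod (w - a))"
  let ?f' = "\<lambda>u v. c * (inner v (sgn (u - a)) / cmod (u - a))"
  have gP: "g t \<in> P" if "t \<in> {0..1}" for t using assms(2) that by (auto simp: path_image_def)
  have ne: "w - a \<noteq> 0" if "w \<in> P" for w using that a by auto
  have der: "(?f has_derivative ?f' u) (at u)" if "u \<in> P" for u
  proof -
    have "((\<lambda>w. w - a) has_derivative (\<lambda>v. v)) (at u)"
      by (auto intro!: derivative_eq_intros)
    from has_derivative_compose[OF this has_derivative_norm[OF ne[OF that]]]
    have "((\<lambda>w. cmod (w - a)) has_derivative (\<lambda>v. inner v (sgn (u - a)))) (at u)" .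
    from has_derivative_ln[OF _ this] ne[OF that]
    have "((\<lambda>w. ln (cmod (w - a))) has_derivative (\<lambda>v. inner v (sgn (u - a)) / cmod (u - a))) (at u)"
      by (simp add: divide_inverse)
    then show ?thesis by (rule has_derivative_mult_right)
  qed
  have "ennreal (norm (?f (g 1) - ?f (g 0))) \<le> conf_length \<rho> g"
  proof (rule potential_difference_le_conf_length[OF assms(1-4), where f' = ?f'])
    show "continuous_on (g ` {0..1}) ?f"
      using gP ne by (intro continuous_intros) auto
    show "(?f has_derivative ?f' (g t)) (at (g t))" if "t \<in> {0<..<1}" for t
      using that by (intro der gP) auto
    show "norm (?f' (g t) v) \<le> \<rho> (g t) * cmod v" if "t \<in> {0<..<1}" for t v
    proof -
      have "g t \<in> P" using that by (intro gP) auto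
      have "\<bar>inner v (sgn (g t - a))\<bar> \<le> cmod v * cmod (sgn (g t - a))"
        by (rule Cauchy_Schwarz_ineq2)
      then have "\<bar>inner v (sgn (g t - a))\<bar> \<le> cmod v"
        using ne[OF \<open>g t \<in> P\<close>] by (simp add: norm_sgn)
      then have "norm (?f' (g t) v) \<le> c * (cmod v / cmod (g t - a))"
        using c(1) by (simp add: abs_mult mult_left_mono divide_right_mono)
      also have "\<dots> = c / cmod (g t - a) * cmod v" by simp
      also have "\<dots> \<le> \<rho> (g t) * cmod v"
        by (intro mult_right_mono c(2) \<open>g t \<in> P\<close>) simp
      finally show ?thesis .
    qed
  qed auto
  also have "norm (?f (g 1) - ?f (g 0)) = c * \<bar>ln (cmod (g 1 - a)) - ln (cmod (g 0 - a))\<bar>"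
    using c(1) by (simp add: right_diff_distrib[symmetric] abs_mult)
  finally show ?thesis .
qed

section \<open>Completeness of the product metric\<close>

lemma open_punctured_plane: "open (punctured_plane \<alpha> p)"
  unfolding punctured_plane_def by (intro open_Diff open_UNIV finite_imp_closed) auto

lemma connected_punctured_plane: "connected (punctured_plane \<alpha> p)"
  unfolding punctured_plane_def by (intro connected_open_delete_finite) auto

lemma product_density_pos:
  assumes "0 < K" "w \<in> punctured_plane \<alpha> p" shows "0 < product_density K M \<alpha> p w"
  using assms unfolding product_density_def punctured_plane_def
  by (intro divide_pos_pos mult_pos_pos prod_pos zero_less_power)
    (auto simp: add_pos_nonneg)

lemma continuous_on_product_density: "continuous_on (punctured_plane \<alpha> p) (product_density K M \<alpha> p)"
  unfolding product_density_def[abs_def] punctured_plane_def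
  by (intro continuous_intros) auto

text \<open>
  The logarithmic potentials confine the end point to a closed annulus around each puncture. The annuli
  are bounded and stay away from the punctures, but there has to be at least one of them; without
  punctures the density is at least \<open>1\<close>, and the Euclidean distance takes over.
\<close>

lemma bounded_paths_end_in_compact:
  assumes p: "p \<le> M + 2" and K: "1 \<le> K" and w: "w \<in> punctured_plane \<alpha> p"
  shows "\<exists>C. compact C \<and> C \<subseteq> punctured_plane \<alpha> p \<and>
    (\<forall>g. valid_path g \<and> path_image g \<subseteq> punctured_plane \<alpha> p \<and> g 0 = w \<and>
       conf_length (product_density K M \<alpha> p) g < ennreal L \<longrightarrow> g 1 \<in> C)"
proof (cases "p \<le> 1")
  case True
  have ge1: "1 \<le> product_density K M \<alpha> p u" for u
  proof -
    have "1 * 1 \<le> K * sqrt (1 + (cmod u)\<^sup>2) ^ M"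
      using K by (intro mult_mono one_le_power) auto
    then show ?thesis using True by (simp add: product_density_def)
  qed
  have UNIV: "punctured_plane \<alpha> p = UNIV"
    using True by (simp add: punctured_plane_def)
  have "g 1 \<in> cball w L"
    if g: "valid_path g" "path_image g \<subseteq> punctured_plane \<alpha> p" "g 0 = w"
      "conf_length (product_density K M \<alpha> p) g < ennreal L" for g
  proof -
    have "ennreal (norm (g 1 - g 0)) \<le> conf_length (product_density K M \<alpha> p) g"
    proof (rule potential_difference_le_conf_length[OF g(1,2) continuous_on_product_density, where f = "\<lambda>u. u" and f' = "\<lambda>_ v. v"])
      show "norm v \<le> product_density K M \<alpha> p (g t) * cmod v" for v t
        using mult_right_mono[OF ge1[of "g t"], of "cmod v"] by simp
    qed (auto intro!: order_trans[OF _ ge1] continuous_intros)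
    also note g(4)
    finally show ?thesis
      using g(3) by (simp add: ennreal_less_iff dist_norm norm_minus_commute)
  qed
  then show ?thesis
    unfolding UNIV by (intro exI[of _ "cball w L"]) auto
next
  case False
  obtain c where c: "0 < c" "\<And>w j. w \<in> punctured_plane \<alpha> p \<Longrightarrow> j \<in> {1..p - 1} \<Longrightarrow>
      c / cmod (w - \<alpha> j) \<le> product_density K M \<alpha> p w"
    using product_density_ge_inverse_dist[OF p K] by metis
  define E where "E = exp (L / c)"
  have "0 < E" by (simp add: E_def)
  define C where "C = {u. \<forall>j\<in>{1..p - 1}. cmod (w - \<alpha> j) / E \<le> cmod (u - \<alpha> j) \<and> cmod (u - \<alpha> j) \<le> cmod (w - \<alpha> j) * E}"
  have pos: "0 < cmod (u - \<alpha> j)" if "u \<in> punctured_plane \<alpha> p" "j \<in> {1..p - 1}" for u j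
    using that by (auto simp: punctured_plane_def)
  have "closed C"
    unfolding C_def Ball_def
    by (intro closed_Collect_all closed_Collect_imp closed_Collect_conj closed_Collect_le continuous_intros)
      auto
  moreover have "C \<subseteq> cball (\<alpha> 1) (cmod (w - \<alpha> 1) * E)"
    using False by (auto simp: C_def dist_norm norm_minus_commute)
  then have "bounded C" using bounded_cball bounded_subset by blast
  ultimately have "compact C" by (simp add: compact_eq_bounded_closed)
  moreover have "C \<subseteq> punctured_plane \<alpha> p"
  proof
    fix u assume u: "u \<in> C"
    have "u \<noteq> \<alpha> j" if j: "j \<in> {1..p - 1}" for j
    proof -
      have "0 < cmod (w - \<alpha> j) / E" using pos[OF w j] \<open>0 < E\<close> by simp
      also have "\<dots> \<le> cmod (u - \<alpha> j)" using u j by (simp add: C_def)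
      finally show ?thesis by auto
    qed
    then show "u \<in> punctured_plane \<alpha> p" unfolding punctured_plane_def by blast
  qed
  moreover have "g 1 \<in> C"
    if g: "valid_path g" "path_image g \<subseteq> punctured_plane \<alpha> p" "g 0 = w"
      "conf_length (product_density K M \<alpha> p) g < ennreal L" for g
    unfolding C_def
  proof (intro CollectI ballI)
    fix j assume j: "j \<in> {1..p - 1}"
    have g1: "g 1 \<in> punctured_plane \<alpha> p" using g(2) by (auto simp: path_image_def image_subset_iff)
    let ?a = "cmod (g 1 - \<alpha> j)" and ?b = "cmod (w - \<alpha> j)"
    have "ennreal (c * \<bar>ln ?a - ln ?b\<bar>) \<le> conf_length (product_density K M \<alpha> p) g"
      unfolding g(3)[symmetric]
      by (rule log_dist_le_conf_length[OF g(1,2) continuous_on_product_density])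
        (use c j product_density_pos[of K] K in \<open>auto simp: punctured_plane_def intro!: less_imp_le\<close>)
    also note g(4)
    finally have "c * \<bar>ln ?a - ln ?b\<bar> < L"
      using c(1) by (simp add: ennreal_less_iff)
    then have "\<bar>ln ?a - ln ?b\<bar> < L / c"
      using c(1) by (simp add: pos_less_divide_eq mult.commute)
    then have le: "ln ?a \<le> ln ?b + L / c" "ln ?b - L / c \<le> ln ?a" by linarith+
    have "?a = exp (ln ?a)" using pos[OF g1 j] by simp
    also have "\<dots> \<le> exp (ln ?b + L / c)" using le(1) by simp
    also have "\<dots> = ?b * E" using pos[OF w j] by (simp add: exp_add E_def)
    finally have 1: "?a \<le> ?b * E" .
    have "?b / E = exp (ln ?b - L / c)" using pos[OF w j] by (simp add: exp_diff E_def)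
    also have "\<dots> \<le> exp (ln ?a)" using le(2) by simp
    also have "\<dots> = ?a" using pos[OF g1 j] by simp
    finally show "?b / E \<le> ?a \<and> ?a \<le> ?b * E" using 1 by simp
  qed
  ultimately show ?thesis by blast
qed

lemma complete_iff_exponent_le:
  assumes cov: "covering_space S z (punctured_plane \<alpha> p)" and conn: "connected S" and K: "1 \<le> K"
  shows "complete_riemannian_metric S z (\<lambda>x v. (product_density K M \<alpha> p (z x) * cmod v)\<^sup>2) \<longleftrightarrow> p \<le> 2 + M"
proof -
  interpret conformal_covering S z "punctured_plane \<alpha> p" "product_density K M \<alpha> p"
    by unfold_locales
      (use cov conn K in \<open>auto intro: open_punctured_plane continuous_on_product_density product_density_pos\<close>)
  show ?thesis
  proof
    assume "p \<le> 2 + M"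
    then show "complete_riemannian_metric S z metric_form"
      by (intro complete_if_bounded_paths_end_in_compact bounded_paths_end_in_compact K) auto
  next
    assume complete: "complete_riemannian_metric S z metric_form"
    show "p \<le> 2 + M"
    proof (rule ccontr)
      assume "\<not> p \<le> 2 + M"
      then have p: "M + 3 \<le> p" by simp
      define R where "R = 1 + 2 * (\<Sum>i = 1..p - 1. cmod (\<alpha> i))"
      define B where "B = K * 2 ^ (M + (p - 1))"
      have R1: "1 \<le> R" by (simp add: R_def sum_nonneg)
      have B0: "0 \<le> B" using K by (simp add: B_def)
      define w where "w n = complex_of_real (R * 2 ^ n)" for n
      have seg: "R * 2 ^ n \<le> cmod u" if "u \<in> closed_segment (w n) (w (Suc n))" for u n
      proof -
        have "R * 2 ^ n \<le> R * 2 ^ Suc n" using R1 by simp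
        then have "closed_segment (R * 2 ^ n) (R * 2 ^ Suc n) = {R * 2 ^ n..R * 2 ^ Suc n}"
          by (simp add: closed_segment_eq_real_ivl)
        with that obtain t where "t \<in> {R * 2 ^ n..R * 2 ^ Suc n}" "u = of_real t"
          unfolding w_def closed_segment_of_real by auto
        then show ?thesis by (simp add: abs_of_nonneg)
      qed
      have far: "R \<le> cmod u" if "u \<in> closed_segment (w n) (w (Suc n))" for u n
      proof -
        have "R * 1 \<le> R * 2 ^ n" using R1 by (intro mult_left_mono) auto
        with seg[OF that] show ?thesis by simp
      qed
      \<comment> \<open>On the segment from \<open>R 2\<^sup>n\<close> to \<open>2 R 2\<^sup>n\<close> the density is at most \<open>B / (R 2\<^sup>n)\<^sup>2\<close>,
        so the length is at most \<open>(B / R) / 2\<^sup>n\<close>.\<close>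
      have "\<not> complete_riemannian_metric S z metric_form"
      proof (rule not_complete_if_short_segments_to_infinity)
        show "closed_segment (w n) (w (Suc n)) \<subseteq> punctured_plane \<alpha> p" for n
        proof
          fix u assume u: "u \<in> closed_segment (w n) (w (Suc n))"
          have "u \<noteq> \<alpha> j" if j: "j \<in> {1..p - 1}" for j
          proof -
            have "cmod (\<alpha> j) < R"
              using sum_cmod_ge[OF j, of \<alpha>] norm_ge_zero[of "\<alpha> j"] unfolding R_def by linarith
            with far[OF u] show ?thesis by auto
          qed
          then show "u \<in> punctured_plane \<alpha> p" unfolding punctured_plane_def by blast
        qed
        show "product_density K M \<alpha> p u \<le> B / (R * 2 ^ n)\<^sup>2"
          if u: "u \<in> closed_segment (w n) (w (Suc n))" for n u
        proof -
          have "product_density K M \<alpha> p u \<le> B / (cmod u)\<^sup>2"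
            unfolding B_def using far[OF u] K by (intro product_density_le_inverse_square p) (auto simp: R_def)
          also have "\<dots> \<le> B / (R * 2 ^ n)\<^sup>2"
          proof (rule divide_left_mono)
            show "(R * 2 ^ n)\<^sup>2 \<le> (cmod u)\<^sup>2" using seg[OF u] R1 by (intro power_mono) auto
            show "0 < (cmod u)\<^sup>2 * (R * 2 ^ n)\<^sup>2" using R1 far[OF u] by (intro mult_pos_pos zero_less_power) auto
          qed (fact B0)
          finally show ?thesis .
        qed
        show "B / (R * 2 ^ n)\<^sup>2 * dist (w n) (w (Suc n)) \<le> (B / R) / 2 ^ n" for n
        proof -
          have "w (Suc n) - w n = of_real (R * 2 ^ n)"
            by (simp add: w_def)
          moreover have "dist (w n) (w (Suc n)) = cmod (w (Suc n) - w n)"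
            by (simp add: dist_norm norm_minus_commute)
          ultimately have "dist (w n) (w (Suc n)) = R * 2 ^ n"
            using R1 by (simp add: norm_mult norm_power)
          then show ?thesis using R1 by (simp add: power2_eq_square)
        qed
        show "filterlim w at_infinity sequentially"
        proof -
          have "filterlim (\<lambda>n. complex_of_real R * 2 ^ n) at_infinity sequentially"
            using R1 by (intro tendsto_mult_filterlim_at_infinity[OF tendsto_const] filterlim_realpow_sequentially_gt1) auto
          moreover have "w = (\<lambda>n. complex_of_real R * 2 ^ n)" by (simp add: w_def fun_eq_iff)
          ultimately show ?thesis by simp
        qed
      qed
      with complete show False by simp
    qed
  qed
qed

section \<open>Omitted values and the sharp examples\<close>

text \<open>
  A homotopy of loops between two constant loops moves their base points along a path.
\<close>

lemma simply_connected_imp_connected_space: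
  fixes S :: "'a::topological_space set"
  assumes "simply_connected S" shows "connected S"
proof (rule path_connected_imp_connected)
  show "path_connected S"
    unfolding path_connected_component
  proof (intro ballI)
    fix a b assume ab: "a \<in> S" "b \<in> S"
    have "homotopic_loops S (\<lambda>_. a) (\<lambda>_. b)"
      by (rule assms[unfolded simply_connected_def, rule_format])
        (use ab in \<open>auto simp: path_def path_image_def pathstart_def pathfinish_def\<close>)
    from homotopic_loops_imp_path_component_value[OF this, of 0]
    show "path_component S a b" by simp
  qed
qed

lemma covering_space_ident: "covering_space S id S"
  by (rule homeomorphism_imp_covering_space[of _ _ _ id]) (simp add: homeomorphism_def)

lemma omitted_values_coordinate:
  assumes "z ` S = punctured_plane \<alpha> p"
  shows "omitted_values S (Some \<circ> z) = insert None (Some ` \<alpha> ` {1..p - 1})"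
proof -
  have "(Some \<circ> z) ` S = Some ` (UNIV - \<alpha> ` {1..p - 1})"
    unfolding assms[unfolded punctured_plane_def, symmetric] by (rule image_comp[symmetric])
  also have "UNIV - \<dots> = insert None (Some ` \<alpha> ` {1..p - 1})"
  proof (rule set_eqI)
    fix v show "v \<in> UNIV - Some ` (UNIV - \<alpha> ` {1..p - 1}) \<longleftrightarrow> v \<in> insert None (Some ` \<alpha> ` {1..p - 1})"
      by (cases v) auto
  qed
  finally show ?thesis
    by (simp add: omitted_values_def)
qed

lemma card_omitted_values:
  assumes "1 \<le> p" "inj_on \<alpha> {1..p - 1}"
  shows "card (insert None (Some ` \<alpha> ` {1..p - 1})) = p"
proof -
  have "card (Some ` \<alpha> ` {1..p - 1}) = p - 1"
    using assms(2) by (simp add: card_image)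
  then show ?thesis using assms(1) by (subst card_insert_disjoint) auto
qed

theorem proposition2p2:
  fixes n k p :: nat
    and m \<iota> :: "nat \<Rightarrow> nat"
    and \<alpha> c :: "nat \<Rightarrow> complex"
  assumes "\<And>i. i \<in> {1..n} \<Longrightarrow> 0 < m i"
    and "1 \<le> k"
    and "strict_mono_on {1..k} \<iota>"
    and "\<iota> ` {1..k} \<subseteq> {1..n}"
    and "1 \<le> p"
    and "inj_on \<alpha> {1..p - 1}"
  defines "I \<equiv> \<iota> ` {1..k}"
  shows
    "(let V = insert None (Some ` \<alpha> ` {1..p - 1}); P = punctured_plane \<alpha> p in
        card V = p \<and>
        ((\<forall>l\<in>{1..k}. V \<subseteq> omitted_values P (Some \<circ> Gmap I c id (\<iota> l))) \<and>
         (complete_riemannian_metric P id (ds2 n m (Gmap I c id) (omega \<alpha> p id))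
            \<longleftrightarrow> p \<le> 2 + (\<Sum>l = 1..k. m (\<iota> l)))) \<and>
        (\<forall>(S :: 'a::topological_space set) z. universal_cover S z P \<longrightarrow>
           (\<forall>l\<in>{1..k}. V \<subseteq> omitted_values S (Some \<circ> Gmap I c z (\<iota> l))) \<and>
           (complete_riemannian_metric S z (ds2 n m (Gmap I c z) (omega \<alpha> p z))
              \<longleftrightarrow> p \<le> 2 + (\<Sum>l = 1..k. m (\<iota> l)))))
     \<and>
     (\<exists>p' \<beta> q. 1 \<le> p' \<and> inj_on \<beta> {1..p' - 1} \<and>
        (\<forall>l\<in>{1..k}. q (\<iota> l) > (2::nat)) \<and>
        (\<Sum>l = 1..k. real (m (\<iota> l)) / (real (q (\<iota> l)) - 2)) = 1 \<and>
        (let P = punctured_plane \<beta> p' in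
           (complete_riemannian_metric P id (ds2 n m (Gmap I c id) (omega \<beta> p' id)) \<and>
            (\<forall>l\<in>{1..k}. card (omitted_values P (Some \<circ> Gmap I c id (\<iota> l))) = q (\<iota> l))) \<and>
           (\<forall>(S :: 'a set) z. universal_cover S z P \<longrightarrow>
              complete_riemannian_metric S z (ds2 n m (Gmap I c z) (omega \<beta> p' z)) \<and>
              (\<forall>l\<in>{1..k}. card (omitted_values S (Some \<circ> Gmap I c z (\<iota> l))) = q (\<iota> l)))))"
proof -
  define M where "M = (\<Sum>l = 1..k. m (\<iota> l))"
  let ?K = "sqrt (\<Prod>i\<in>{1..n} - I. (1 + (cmod (c i))\<^sup>2) ^ m i)"
  have inj: "inj_on \<iota> {1..k}"
    using assms(3) by (rule strict_mono_on_imp_inj_on)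
  have M: "(\<Sum>i\<in>I. m i) = M"
    unfolding I_def M_def using inj by (simp add: sum.reindex)
  have "1 \<le> (\<Prod>i\<in>{1..n} - I. (1 + (cmod (c i))\<^sup>2) ^ m i)"
    by (intro prod_ge_1 one_le_power) auto
  then have K: "1 \<le> ?K" by simp
  have G: "Gmap I c z (\<iota> l) = z" if "l \<in> {1..k}" for l and z :: "'b \<Rightarrow> complex"
    using that by (simp add: Gmap_def I_def)
  have complete: "complete_riemannian_metric S z (ds2 n m (Gmap I c z) (omega \<beta> r z)) \<longleftrightarrow> r \<le> 2 + M"
    if "covering_space S z (punctured_plane \<beta> r)" "connected S"
    for S and z :: "'b::topological_space \<Rightarrow> complex" and \<beta> r
    using complete_iff_exponent_le[OF that K, of M] ds2_eq_product_density[OF assms(4)[folded I_def], of m c z \<beta> r]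
    by (simp add: M)
  have universal: "covering_space S z P \<and> connected S" if "universal_cover S z P"
    for S and z :: "'a \<Rightarrow> complex" and P
    using that simply_connected_imp_connected_space by (auto simp: universal_cover_def)
  have omitted: "omitted_values S (Some \<circ> Gmap I c z (\<iota> l)) = insert None (Some ` \<beta> ` {1..r - 1})"
    if "covering_space S z (punctured_plane \<beta> r)" "l \<in> {1..k}"
    for S and z :: "'b::topological_space \<Rightarrow> complex" and \<beta> r l
    unfolding G[OF that(2)]
    by (rule omitted_values_coordinate[OF covering_space_imp_surjective[OF that(1)]])
  have "0 < m (\<iota> l)" if "l \<in> {1..k}" for l
    by (intro assms(1) subsetD[OF assms(4)] imageI that)
  then have "0 < M"
    unfolding M_def using assms(2) by (intro sum_pos) auto
  have equality: "(\<Sum>l = 1..k. real (m (\<iota> l)) / (real (2 + M) - 2)) = 1"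
  proof -
    have "(\<Sum>l = 1..k. real (m (\<iota> l)) / (real (2 + M) - 2)) = (\<Sum>l = 1..k. real (m (\<iota> l))) / real M"
      by (simp add: sum_divide_distrib)
    also have "(\<Sum>l = 1..k. real (m (\<iota> l))) = real M"
      by (simp add: M_def)
    finally show ?thesis using \<open>0 < M\<close> by simp
  qed
  have inj_nat: "inj_on (of_nat :: nat \<Rightarrow> complex) {1..2 + M - 1}"
    by (simp add: inj_on_def)
  note plane = covering_space_ident connected_punctured_plane
  show ?thesis
    unfolding Let_def M_def[symmetric]
  proof (intro conjI)
    show "card (insert None (Some ` \<alpha> ` {1..p - 1})) = p"
      by (rule card_omitted_values[OF assms(5,6)])
    show "\<forall>l\<in>{1..k}. insert None (Some ` \<alpha> ` {1..p - 1})
        \<subseteq> omitted_values (punctured_plane \<alpha> p) (Some \<circ> Gmap I c id (\<iota> l))"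
      using omitted[OF plane(1)] by simp
    show "complete_riemannian_metric (punctured_plane \<alpha> p) id (ds2 n m (Gmap I c id) (omega \<alpha> p id))
        \<longleftrightarrow> p \<le> 2 + M"
      by (rule complete[OF plane])
    show "\<forall>(S :: 'a set) z. universal_cover S z (punctured_plane \<alpha> p) \<longrightarrow>
        (\<forall>l\<in>{1..k}. insert None (Some ` \<alpha> ` {1..p - 1}) \<subseteq> omitted_values S (Some \<circ> Gmap I c z (\<iota> l))) \<and>
        (complete_riemannian_metric S z (ds2 n m (Gmap I c z) (omega \<alpha> p z)) \<longleftrightarrow> p \<le> 2 + M)"
    proof (intro allI impI conjI ballI)
      fix S :: "'a set" and z assume "universal_cover S z (punctured_plane \<alpha> p)"
      from universal[OF this] have cov: "covering_space S z (punctured_plane \<alpha> p)" "connected S"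
        by simp_all
      show "insert None (Some ` \<alpha> ` {1..p - 1}) \<subseteq> omitted_values S (Some \<circ> Gmap I c z (\<iota> l))"
        if "l \<in> {1..k}" for l
        using omitted[OF cov(1) that] by simp
      show "complete_riemannian_metric S z (ds2 n m (Gmap I c z) (omega \<alpha> p z)) \<longleftrightarrow> p \<le> 2 + M"
        by (rule complete[OF cov])
    qed
    show "\<exists>p' \<beta> q. 1 \<le> p' \<and> inj_on \<beta> {1..p' - 1} \<and> (\<forall>l\<in>{1..k}. q (\<iota> l) > (2::nat)) \<and>
        (\<Sum>l = 1..k. real (m (\<iota> l)) / (real (q (\<iota> l)) - 2)) = 1 \<and>
        (complete_riemannian_metric (punctured_plane \<beta> p') id (ds2 n m (Gmap I c id) (omega \<beta> p' id)) \<and>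
         (\<forall>l\<in>{1..k}. card (omitted_values (punctured_plane \<beta> p') (Some \<circ> Gmap I c id (\<iota> l))) = q (\<iota> l))) \<and>
        (\<forall>(S :: 'a set) z. universal_cover S z (punctured_plane \<beta> p') \<longrightarrow>
           complete_riemannian_metric S z (ds2 n m (Gmap I c z) (omega \<beta> p' z)) \<and>
           (\<forall>l\<in>{1..k}. card (omitted_values S (Some \<circ> Gmap I c z (\<iota> l))) = q (\<iota> l)))"
    \<comment> \<open>The extremal case: any \<open>1 + M\<close> distinct punctures, with every \<open>q\<close> equal to \<open>2 + M\<close>.\<close>
    proof (intro exI conjI)
      show "(\<Sum>l = 1..k. real (m (\<iota> l)) / (real ((\<lambda>_. 2 + M) (\<iota> l)) - 2)) = 1"
        by (rule equality)
      show "complete_riemannian_metric (punctured_plane of_nat (2 + M)) id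
          (ds2 n m (Gmap I c id) (omega of_nat (2 + M) id))"
        using complete[OF plane] by blast
      show "\<forall>l\<in>{1..k}. card (omitted_values (punctured_plane of_nat (2 + M)) (Some \<circ> Gmap I c id (\<iota> l))) = 2 + M"
        using omitted[OF plane(1)] card_omitted_values[OF _ inj_nat] by simp
      show "\<forall>(S :: 'a set) z. universal_cover S z (punctured_plane of_nat (2 + M)) \<longrightarrow>
           complete_riemannian_metric S z (ds2 n m (Gmap I c z) (omega of_nat (2 + M) z)) \<and>
           (\<forall>l\<in>{1..k}. card (omitted_values S (Some \<circ> Gmap I c z (\<iota> l))) = 2 + M)"
      proof (intro allI impI conjI ballI)
        fix S :: "'a set" and z
        assume "universal_cover S z (punctured_plane of_nat (2 + M))"
        from universal[OF this] have cov: "covering_space S z (punctured_plane of_nat (2 + M))" "connected S"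
          by simp_all
        show "complete_riemannian_metric S z (ds2 n m (Gmap I c z) (omega of_nat (2 + M) z))"
          using complete[OF cov] by simp
        show "card (omitted_values S (Some \<circ> Gmap I c z (\<iota> l))) = 2 + M" if "l \<in> {1..k}" for l
          unfolding omitted[OF cov(1) that] by (rule card_omitted_values[OF _ inj_nat]) simp
      qed
    qed (use inj_nat \<open>0 < M\<close> in auto)
  qed
qed

end
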